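(* Suppose $X$ is a diffeological quasifold, and $\mathcal{A}=\{F_i:U_i\to V_i/\Gamma_i\}$ is a countable atlas of $X$. Let $\Psi$ be the pseudogroup on $V=\bigsqcup_iV_i$ associated to $\mathcal{A}$, and let $(M,\mathcal{F})$ be the foliated manifold constructed from a countable generating set of $\Psi$ as described in the context (so that $X\cong V/\Psi\cong M/\mathcal{F}$). If each $V_i$ carries a Riemannian metric such that $\Gamma_i$ acts by isometries, and if $\Psi$ consists entirely of local isometries, then $(M,\mathcal{F})$ is a Riemannian foliation.
   Context: Manifolds are Hausdorff and second-countable; foliations are regular. **Diffeology and quasifolds.** A diffeology on a set $X$ is a collection of maps (plots) from open subsets of Cartesian spaces into $X$, containing all locally constant maps, closed under precomposition with smooth maps between open subsets of Cartesian spaces, and containing every map that is locally a plot. A map is smooth if it sends plots to plots by composition. The D-topology is the finest topology making all plots continuous. Subsets carry the subset diffeology (plots with image in the subset); quotients carry the quotient diffeology, whose plots are the maps that locally lift to plots upstairs; manifolds carry the diffeology of all smooth maps. A diffeological quasifold of dimension $n$ is a diffeological space $X$, second-countable in the D-topology, such that every point has a D-open neighbourhood $U$ with a diffeological diffeomorphism $F:U\to V/\Gamma$ (a quasifold chart), where $\Gamma\le\operatorname{Aff}(\mathbb{R}^n)$ is countable and $V\subseteq\mathbb{R}^n$ is open and $\Gamma$-invariant. An atlas is a collection of quasifold charts whose domains cover $X$. **Pseudogroups.** A transition of a manifold $N$ is a diffeomorphism between open subsets of $N$. A pseudogroup on $N$ is a collection of transitions containing the identity, closed under composition, inversion and restriction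 to open subsets, and containing every transition that is locally in the collection. It is generated by transitions $\psi_i$ if it is the smallest pseudogroup containing them. **Pseudogroup of an atlas.** Given a countable atlas $\{F_i:U_i\to V_i/\Gamma_i\}$, with quotient maps $\pi_i:V_i\to V_i/\Gamma_i$, let $V=\bigsqcup_iV_i$. $\Psi$ is the pseudogroup on $V$ consisting (locally) of all transitions $\psi$ from open subsets of $V_i$ to open subsets of $V_j$ satisfying $F_i^{-1}\circ\pi_i=F_j^{-1}\circ\pi_j\circ\psi$ on $\operatorname{dom}\psi$. It is countably generated and $V/\Psi\cong X$. **Foliation from a countably generated pseudogroup.** Let $N$ be a manifold (here $N=\bigsqcup_iV_i$) and $\{\psi_i\}_{i=1}^\infty$ a countable set of transitions of $N$ generating $\Psi$. Put $W=(N\times\mathbb{R}\times(0,1))\cup\bigcup_{i=1}^\infty(\operatorname{dom}\psi_i\times(i,i+1)\times(0,3))$, an open subset of $N\times\mathbb{R}\times\mathbb{R}$. Let ${\sim}$ be the equivalence relation on $W$ generated by $(x,s,t)\sim(\psi_i(x),s,t-2)$ whenever $s\in(i,i+1)$, $x\in\operatorname{dom}\psi_i$, $t\in(2,3)$. Then $M=W/{\sim}$ is a manifold with quotient map $W\to M$ a submersion, and $\mathcal{F}$ is the foliation on $M$ induced by the foliation of $W$ by the fibres of the first projection $W\to N$. **Riemannian foliations.** $(M,\mathcal{F})$ is Riemannian if it admits a bundle-like metric, or equivalently a transversely Riemannian metric: a non-negative symmetric $(0,2)$-tensor $g$ inducing an inner product on $TM/T\mathcal{F}$, with $\iota_Yg=0$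 and $\mathcal{L}_Yg=0$ for all vector fields $Y$ tangent to $\mathcal{F}$. *)

theory Defs
  imports "HOL-Analysis.Analysis" "HOL-Algebra.Bij"
begin

section \<open>Smooth maps between open subsets of Cartesian spaces\<close>

text \<open>
  The dimension is a natural number (possibly 0): points of the \<open>n\<close>-dimensional Cartesian space are
  the sequences vanishing from index \<open>n\<close> on, with the topology \<^const>\<open>Euclidean_space\<close>.
\<close>

abbreviation cart :: "nat \<Rightarrow> (nat \<Rightarrow> real) set" where
  "cart n \<equiv> topspace (Euclidean_space n)"

definition pd :: "nat \<Rightarrow> ((nat \<Rightarrow> real) \<Rightarrow> real) \<Rightarrow> (nat \<Rightarrow> real) \<Rightarrow> real" where
  "pd i f x = deriv (\<lambda>t. f (x(i := t))) (x i)"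

text \<open>Only meaningful for open \<open>U\<close>; the values of \<open>f\<close> outside \<open>U\<close> are then irrelevant.\<close>

primrec Ck :: "nat \<Rightarrow> nat \<Rightarrow> (nat \<Rightarrow> real) set \<Rightarrow> ((nat \<Rightarrow> real) \<Rightarrow> real) \<Rightarrow> bool" where
  "Ck 0 n U f \<longleftrightarrow> continuous_map (subtopology (Euclidean_space n) U) euclideanreal f"
| "Ck (Suc k) n U f \<longleftrightarrow> continuous_map (subtopology (Euclidean_space n) U) euclideanreal f \<and>
     (\<forall>i<n. (\<forall>x\<in>U. (\<lambda>t. f (x(i := t))) differentiable (at (x i))) \<and> Ck k n U (pd i f))"

definition smooth :: "nat \<Rightarrow> (nat \<Rightarrow> real) set \<Rightarrow> ((nat \<Rightarrow> real) \<Rightarrow> real) \<Rightarrow> bool" where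
  "smooth n U f \<longleftrightarrow> (\<forall>k. Ck k n U f)"

definition smooth_map ::
    "nat \<Rightarrow> nat \<Rightarrow> (nat \<Rightarrow> real) set \<Rightarrow> ((nat \<Rightarrow> real) \<Rightarrow> nat \<Rightarrow> real) \<Rightarrow> bool" where
  "smooth_map m n U f \<longleftrightarrow> f ` U \<subseteq> cart n \<and> (\<forall>k<n. smooth m U (\<lambda>x. f x k))"


section \<open>Diffeology\<close>

text \<open>
  A plot is a triple \<open>(m, U, p)\<close>, where \<open>U\<close> is an open subset of the \<open>m\<close>-dimensional Cartesian
  space and \<open>p\<close> matters only on \<open>U\<close>; the locality axiom makes the collection of plots insensitive
  to the values of \<open>p\<close> elsewhere.
\<close>

type_synonym 'x plot = "nat \<times> (nat \<Rightarrow> real) set \<times> ((nat \<Rightarrow> real) \<Rightarrow> 'x)"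

definition diffeology :: "'x set \<Rightarrow> 'x plot set \<Rightarrow> bool" where
  "diffeology X D \<longleftrightarrow>
     (\<forall>m U p. (m, U, p) \<in> D \<longrightarrow> openin (Euclidean_space m) U \<and> p ` U \<subseteq> X) \<and>
     (\<forall>m U p. openin (Euclidean_space m) U \<and> p ` U \<subseteq> X \<and>
        (\<forall>u\<in>U. \<exists>Q. openin (Euclidean_space m) Q \<and> u \<in> Q \<and> Q \<subseteq> U \<and> (\<forall>y\<in>Q. p y = p u))
        \<longrightarrow> (m, U, p) \<in> D) \<and>
     (\<forall>m U p l Q f. (m, U, p) \<in> D \<and> openin (Euclidean_space l) Q \<and> smooth_map l m Q f \<and> f ` Q \<subseteq> U
        \<longrightarrow> (l, Q, p \<circ> f) \<in> D) \<and>
     (\<forall>m U p. openin (Euclidean_space m) U \<and>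
        (\<forall>u\<in>U. \<exists>Q p'. u \<in> Q \<and> Q \<subseteq> U \<and> (m, Q, p') \<in> D \<and> (\<forall>y\<in>Q. p y = p' y))
        \<longrightarrow> (m, U, p) \<in> D)"

text \<open>The openness premise in the definition is automatic for plots of a diffeology.\<close>

definition D_topology :: "'x set \<Rightarrow> 'x plot set \<Rightarrow> 'x topology" where
  "D_topology X D = topology (\<lambda>A. A \<subseteq> X \<and>
     (\<forall>(m, U, p)\<in>D. openin (Euclidean_space m) U \<longrightarrow> openin (Euclidean_space m) {u\<in>U. p u \<in> A}))"

lemma istopology_D_topology:
  "istopology (\<lambda>A. A \<subseteq> X \<and>
     (\<forall>(m, U, p)\<in>D. openin (Euclidean_space m) U \<longrightarrow> openin (Euclidean_space m) {u\<in>U. p u \<in> A}))"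
proof -
  have 1: "{u\<in>U. p u \<in> S \<inter> T} = {u\<in>U. p u \<in> S} \<inter> {u\<in>U. p u \<in> T}" for U p and S T :: "'x set"
    by auto
  have 2: "{u\<in>U. p u \<in> \<Union>\<K>} = (\<Union>K\<in>\<K>. {u\<in>U. p u \<in> K})" for U p and \<K> :: "'x set set"
    by auto
  show ?thesis
    unfolding istopology_def 1 2 by (fastforce intro!: openin_Int openin_Union)
qed

lemma openin_D_topology:
  "openin (D_topology X D) A \<longleftrightarrow> A \<subseteq> X \<and>
     (\<forall>(m, U, p)\<in>D. openin (Euclidean_space m) U \<longrightarrow> openin (Euclidean_space m) {u\<in>U. p u \<in> A})"
  unfolding D_topology_def by (simp add: istopology_D_topology)

definition subset_diffeology :: "'x plot set \<Rightarrow> 'x set \<Rightarrow> 'x plot set" where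
  "subset_diffeology D A = {(m, U, p). (m, U, p) \<in> D \<and> p ` U \<subseteq> A}"

definition quotient_diffeology :: "('x \<Rightarrow> 'y) \<Rightarrow> 'x plot set \<Rightarrow> 'y plot set" where
  "quotient_diffeology \<pi> D = {(m, U, p). openin (Euclidean_space m) U \<and>
     (\<forall>u\<in>U. \<exists>Q p'. u \<in> Q \<and> Q \<subseteq> U \<and> (m, Q, p') \<in> D \<and> (\<forall>y\<in>Q. p y = \<pi> (p' y)))}"

definition standard_diffeology :: "nat \<Rightarrow> (nat \<Rightarrow> real) set \<Rightarrow> (nat \<Rightarrow> real) plot set" where
  "standard_diffeology n V =
     {(m, U, p). openin (Euclidean_space m) U \<and> smooth_map m n U p \<and> p ` U \<subseteq> V}"

definition diffeo_smooth ::
    "'x set \<Rightarrow> 'x plot set \<Rightarrow> 'y set \<Rightarrow> 'y plot set \<Rightarrow> ('x \<Rightarrow> 'y) \<Rightarrow> bool" where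
  "diffeo_smooth X D Y E f \<longleftrightarrow> f ` X \<subseteq> Y \<and> (\<forall>(m, U, p)\<in>D. (m, U, f \<circ> p) \<in> E)"

definition diffeological_diffeomorphism ::
    "'x set \<Rightarrow> 'x plot set \<Rightarrow> 'y set \<Rightarrow> 'y plot set \<Rightarrow> ('x \<Rightarrow> 'y) \<Rightarrow> bool" where
  "diffeological_diffeomorphism X D Y E f \<longleftrightarrow>
     bij_betw f X Y \<and> diffeo_smooth X D Y E f \<and> diffeo_smooth Y E X D (inv_into X f)"


section \<open>Diffeological quasifolds\<close>

text \<open>Bijectivity is part of \<^const>\<open>Bij\<close>, so the linear part \<open>A\<close> is automatically invertible.\<close>

definition affine_group :: "nat \<Rightarrow> ((nat \<Rightarrow> real) \<Rightarrow> nat \<Rightarrow> real) set" where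
  "affine_group n = {\<gamma> \<in> Bij (cart n). \<exists>A b. \<forall>x\<in>cart n. \<forall>i<n. \<gamma> x i = (\<Sum>j<n. A i j * x j) + b i}"

definition orbit :: "((nat \<Rightarrow> real) \<Rightarrow> nat \<Rightarrow> real) set \<Rightarrow> (nat \<Rightarrow> real) \<Rightarrow> (nat \<Rightarrow> real) set" where
  "orbit \<Gamma> x = (\<lambda>\<gamma>. \<gamma> x) ` \<Gamma>"

text \<open>The quotient map from \<open>V\<close> to the quotient of \<open>V\<close> by \<open>\<Gamma>\<close> is \<^term>\<open>orbit \<Gamma>\<close>.\<close>

definition quasifold_chart ::
    "nat \<Rightarrow> 'x set \<Rightarrow> 'x plot set \<Rightarrow> 'x set \<Rightarrow> ('x \<Rightarrow> (nat \<Rightarrow> real) set) \<Rightarrow>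
     (nat \<Rightarrow> real) set \<Rightarrow> ((nat \<Rightarrow> real) \<Rightarrow> nat \<Rightarrow> real) set \<Rightarrow> bool" where
  "quasifold_chart n X D U F V \<Gamma> \<longleftrightarrow>
     openin (D_topology X D) U \<and>
     openin (Euclidean_space n) V \<and>
     \<Gamma> \<subseteq> affine_group n \<and> subgroup \<Gamma> (BijGroup (cart n)) \<and> countable \<Gamma> \<and>
     (\<forall>\<gamma>\<in>\<Gamma>. \<gamma> ` V \<subseteq> V) \<and>
     diffeological_diffeomorphism U (subset_diffeology D U)
       (orbit \<Gamma> ` V) (quotient_diffeology (orbit \<Gamma>) (standard_diffeology n V)) F"

definition diffeological_quasifold :: "nat \<Rightarrow> 'x set \<Rightarrow> 'x plot set \<Rightarrow> bool" where
  "diffeological_quasifold n X D \<longleftrightarrow>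
     diffeology X D \<and> second_countable (D_topology X D) \<and>
     (\<forall>x\<in>X. \<exists>U F V \<Gamma>. x \<in> U \<and> quasifold_chart n X D U F V \<Gamma>)"

definition countable_atlas ::
    "nat \<Rightarrow> 'x set \<Rightarrow> 'x plot set \<Rightarrow> 'i set \<Rightarrow> ('i \<Rightarrow> 'x set) \<Rightarrow> ('i \<Rightarrow> 'x \<Rightarrow> (nat \<Rightarrow> real) set) \<Rightarrow>
     ('i \<Rightarrow> (nat \<Rightarrow> real) set) \<Rightarrow> ('i \<Rightarrow> ((nat \<Rightarrow> real) \<Rightarrow> nat \<Rightarrow> real) set) \<Rightarrow> bool" where
  "countable_atlas n X D I U F V \<Gamma> \<longleftrightarrow>
     countable I \<and> (\<forall>i\<in>I. quasifold_chart n X D (U i) (F i) (V i) (\<Gamma> i)) \<and> (\<Union>i\<in>I. U i) = X"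


section \<open>Manifolds, transitions and pseudogroups\<close>

type_synonym 'a chart = "'a set \<times> ('a \<Rightarrow> nat \<Rightarrow> real)"

definition chart_image :: "'a chart \<Rightarrow> (nat \<Rightarrow> real) set" where
  "chart_image c = snd c ` fst c"

text \<open>The coordinate change from \<open>c\<close> to \<open>c'\<close>, relevant on \<open>snd c ` (fst c \<inter> fst c')\<close>.\<close>

definition coord_change :: "'a chart \<Rightarrow> 'a chart \<Rightarrow> (nat \<Rightarrow> real) \<Rightarrow> nat \<Rightarrow> real" where
  "coord_change c c' = snd c' \<circ> inv_into (fst c) (snd c)"

definition is_chart :: "nat \<Rightarrow> 'a topology \<Rightarrow> 'a chart \<Rightarrow> bool" where
  "is_chart n X c \<longleftrightarrow> openin X (fst c) \<and> openin (Euclidean_space n) (chart_image c) \<and>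
     homeomorphic_map (subtopology X (fst c)) (subtopology (Euclidean_space n) (chart_image c)) (snd c)"

text \<open>The atlas is not required to be maximal.\<close>

definition smooth_manifold :: "nat \<Rightarrow> 'a topology \<Rightarrow> 'a chart set \<Rightarrow> bool" where
  "smooth_manifold n X A \<longleftrightarrow>
     Hausdorff_space X \<and> second_countable X \<and>
     (\<forall>c\<in>A. is_chart n X c) \<and> (\<Union>c\<in>A. fst c) = topspace X \<and>
     (\<forall>c\<in>A. \<forall>c'\<in>A. smooth_map n n (snd c ` (fst c \<inter> fst c')) (coord_change c c'))"

definition manifold_smooth ::
    "nat \<Rightarrow> 'a topology \<Rightarrow> 'a chart set \<Rightarrow> 'a set \<Rightarrow> nat \<Rightarrow> 'b topology \<Rightarrow> 'b chart set \<Rightarrow> ('a \<Rightarrow> 'b) \<Rightarrow> bool"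
  where
  "manifold_smooth n X A S m Y B f \<longleftrightarrow>
     continuous_map (subtopology X S) Y f \<and>
     (\<forall>c\<in>A. \<forall>c'\<in>B. smooth_map n m (snd c ` {x \<in> fst c \<inter> S. f x \<in> fst c'})
        (snd c' \<circ> f \<circ> inv_into (fst c) (snd c)))"

text \<open>Transitions are partial maps, so that equality of transitions includes equality of domains.\<close>

definition partial_inverse :: "('a \<rightharpoonup> 'b) \<Rightarrow> 'b \<rightharpoonup> 'a" where
  "partial_inverse \<psi> y = (if y \<in> ran \<psi> then Some (SOME x. \<psi> x = Some y) else None)"

definition transition :: "nat \<Rightarrow> 'a topology \<Rightarrow> 'a chart set \<Rightarrow> ('a \<rightharpoonup> 'a) \<Rightarrow> bool" where
  "transition n N A \<psi> \<longleftrightarrow>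
     openin N (dom \<psi>) \<and> openin N (ran \<psi>) \<and> inj_on \<psi> (dom \<psi>) \<and>
     manifold_smooth n N A (dom \<psi>) n N A (the \<circ> \<psi>) \<and>
     manifold_smooth n N A (ran \<psi>) n N A (the \<circ> partial_inverse \<psi>)"

definition pseudogroup :: "nat \<Rightarrow> 'a topology \<Rightarrow> 'a chart set \<Rightarrow> ('a \<rightharpoonup> 'a) set \<Rightarrow> bool" where
  "pseudogroup n N A P \<longleftrightarrow>
     (\<forall>\<psi>\<in>P. transition n N A \<psi>) \<and>
     Some |` topspace N \<in> P \<and>
     (\<forall>\<phi>\<in>P. \<forall>\<psi>\<in>P. \<psi> \<circ>\<^sub>m \<phi> \<in> P) \<and>
     (\<forall>\<psi>\<in>P. partial_inverse \<psi> \<in> P) \<and>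
     (\<forall>\<psi>\<in>P. \<forall>Q. openin N Q \<longrightarrow> \<psi> |` Q \<in> P) \<and>
     (\<forall>\<psi>. transition n N A \<psi> \<and> (\<forall>x\<in>dom \<psi>. \<exists>Q. openin N Q \<and> x \<in> Q \<and> \<psi> |` Q \<in> P) \<longrightarrow> \<psi> \<in> P)"

definition generates_pseudogroup ::
    "nat \<Rightarrow> 'a topology \<Rightarrow> 'a chart set \<Rightarrow> ('a \<rightharpoonup> 'a) set \<Rightarrow> ('a \<rightharpoonup> 'a) set \<Rightarrow> bool" where
  "generates_pseudogroup n N A G P \<longleftrightarrow>
     (\<forall>\<psi>\<in>G. transition n N A \<psi>) \<and> P = \<Inter>{P'. pseudogroup n N A P' \<and> G \<subseteq> P'}"


section \<open>The pseudogroup of a quasifold atlas\<close>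

definition union_topology :: "nat \<Rightarrow> 'i set \<Rightarrow> ('i \<Rightarrow> (nat \<Rightarrow> real) set) \<Rightarrow> ('i \<times> (nat \<Rightarrow> real)) topology"
  where "union_topology n I V = sum_topology (\<lambda>i. subtopology (Euclidean_space n) (V i)) I"

definition union_charts :: "'i set \<Rightarrow> ('i \<Rightarrow> (nat \<Rightarrow> real) set) \<Rightarrow> ('i \<times> (nat \<Rightarrow> real)) chart set" where
  "union_charts I V = (\<lambda>i. ({i} \<times> V i, snd)) ` I"

definition atlas_transitions ::
    "nat \<Rightarrow> 'i set \<Rightarrow> ('i \<Rightarrow> 'x set) \<Rightarrow> ('i \<Rightarrow> 'x \<Rightarrow> (nat \<Rightarrow> real) set) \<Rightarrow>
     ('i \<Rightarrow> (nat \<Rightarrow> real) set) \<Rightarrow> ('i \<Rightarrow> ((nat \<Rightarrow> real) \<Rightarrow> nat \<Rightarrow> real) set) \<Rightarrow>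
     ('i \<times> (nat \<Rightarrow> real) \<rightharpoonup> 'i \<times> (nat \<Rightarrow> real)) set" where
  "atlas_transitions n I U F V \<Gamma> = {\<psi>. transition n (union_topology n I V) (union_charts I V) \<psi> \<and>
     (\<exists>i\<in>I. \<exists>j\<in>I. dom \<psi> \<subseteq> {i} \<times> V i \<and> ran \<psi> \<subseteq> {j} \<times> V j \<and>
        (\<forall>x y. \<psi> (i, x) = Some (j, y) \<longrightarrow>
           inv_into (U i) (F i) (orbit (\<Gamma> i) x) = inv_into (U j) (F j) (orbit (\<Gamma> j) y)))}"

definition atlas_pseudogroup ::
    "nat \<Rightarrow> 'i set \<Rightarrow> ('i \<Rightarrow> 'x set) \<Rightarrow> ('i \<Rightarrow> 'x \<Rightarrow> (nat \<Rightarrow> real) set) \<Rightarrow>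
     ('i \<Rightarrow> (nat \<Rightarrow> real) set) \<Rightarrow> ('i \<Rightarrow> ((nat \<Rightarrow> real) \<Rightarrow> nat \<Rightarrow> real) set) \<Rightarrow>
     ('i \<times> (nat \<Rightarrow> real) \<rightharpoonup> 'i \<times> (nat \<Rightarrow> real)) set" where
  "atlas_pseudogroup n I U F V \<Gamma> = {\<psi>. transition n (union_topology n I V) (union_charts I V) \<psi> \<and>
     (\<forall>p\<in>dom \<psi>. \<exists>Q. openin (union_topology n I V) Q \<and> p \<in> Q \<and>
        \<psi> |` Q \<in> atlas_transitions n I U F V \<Gamma>)}"


section \<open>Foliations and the foliated manifold of a generated pseudogroup\<close>

text \<open>
  A foliation of codimension \<open>q\<close> on an \<open>n\<close>-manifold is given by a foliated atlas, which determines the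
  smooth structure as well: in each chart the first \<open>q\<close> coordinates are the transverse ones, the plaques
  are their level sets, and coordinate changes locally send plaques into plaques.
\<close>

definition foliated_manifold :: "nat \<Rightarrow> nat \<Rightarrow> 'a topology \<Rightarrow> 'a chart set \<Rightarrow> bool" where
  "foliated_manifold n q X A \<longleftrightarrow>
     smooth_manifold n X A \<and> q \<le> n \<and>
     (\<forall>c\<in>A. \<forall>c'\<in>A. \<forall>p\<in>fst c \<inter> fst c'. \<exists>Q. openin X Q \<and> p \<in> Q \<and> Q \<subseteq> fst c \<inter> fst c' \<and>
        (\<forall>x\<in>Q. \<forall>y\<in>Q. (\<forall>k<q. snd c x k = snd c y k) \<longrightarrow> (\<forall>k<q. snd c' x k = snd c' y k)))"

text \<open>In the following, the generating transitions are \<open>\<psi> 1, \<psi> 2, \<dots>\<close>; the value \<open>\<psi> 0\<close> is not used.\<close>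

definition W_set :: "'a set \<Rightarrow> (nat \<Rightarrow> 'a \<rightharpoonup> 'a) \<Rightarrow> ('a \<times> real \<times> real) set" where
  "W_set N \<psi> = N \<times> UNIV \<times> {0<..<1} \<union>
     (\<Union>i\<in>{1..}. dom (\<psi> i) \<times> {real i<..<real i + 1} \<times> {0<..<3})"

definition W_topology :: "'a topology \<Rightarrow> (nat \<Rightarrow> 'a \<rightharpoonup> 'a) \<Rightarrow> ('a \<times> real \<times> real) topology" where
  "W_topology N \<psi> = subtopology (prod_topology N (prod_topology euclideanreal euclideanreal))
     (W_set (topspace N) \<psi>)"

text \<open>
  These charts are adapted to the foliation of \<open>W\<close> by the fibres of the projection to \<open>N\<close>: the
  transverse coordinates are those of \<open>N\<close>, and the leaf coordinates \<open>s\<close>, \<open>t\<close> have indices \<open>n\<close>, \<open>n + 1\<close>.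
\<close>

definition W_charts ::
    "nat \<Rightarrow> 'a topology \<Rightarrow> 'a chart set \<Rightarrow> (nat \<Rightarrow> 'a \<rightharpoonup> 'a) \<Rightarrow> ('a \<times> real \<times> real) chart set" where
  "W_charts n N A \<psi> = (\<lambda>(U, \<phi>). ((U \<times> UNIV \<times> UNIV) \<inter> W_set (topspace N) \<psi>,
     \<lambda>(x, s, t). (\<phi> x)(n := s, n + 1 := t))) ` A"

definition W_glue :: "(nat \<Rightarrow> 'a \<rightharpoonup> 'a) \<Rightarrow> 'a \<times> real \<times> real \<Rightarrow> 'a \<times> real \<times> real \<Rightarrow> bool" where
  "W_glue \<psi> p p' \<longleftrightarrow> (\<exists>i\<ge>1. \<exists>x y s t. \<psi> i x = Some y \<and> real i < s \<and> s < real i + 1 \<and> 2 < t \<and> t < 3 \<and>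
     p = (x, s, t) \<and> p' = (y, s, t - 2))"

definition M_proj :: "'a set \<Rightarrow> (nat \<Rightarrow> 'a \<rightharpoonup> 'a) \<Rightarrow> 'a \<times> real \<times> real \<Rightarrow> ('a \<times> real \<times> real) set" where
  "M_proj N \<psi> p = {p' \<in> W_set N \<psi>. equivclp (W_glue \<psi>) p p'}"

definition quotient_topology :: "'a topology \<Rightarrow> ('a \<Rightarrow> 'b) \<Rightarrow> 'b topology" where
  "quotient_topology X \<pi> = topology (\<lambda>B. B \<subseteq> \<pi> ` topspace X \<and> openin X {x \<in> topspace X. \<pi> x \<in> B})"

lemma istopology_quotient_topology:
  "istopology (\<lambda>B. B \<subseteq> \<pi> ` topspace X \<and> openin X {x \<in> topspace X. \<pi> x \<in> B})"
proof -
  have 1: "{x \<in> topspace X. \<pi> x \<in> S \<inter> T} = {x \<in> topspace X. \<pi> x \<in> S} \<inter> {x \<in> topspace X. \<pi> x \<in> T}" for S T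
    by auto
  have 2: "{x \<in> topspace X. \<pi> x \<in> \<Union>\<K>} = (\<Union>K\<in>\<K>. {x \<in> topspace X. \<pi> x \<in> K})" for \<K>
    by auto
  show ?thesis
    unfolding istopology_def 1 2 by blast
qed

lemma openin_quotient_topology:
  "openin (quotient_topology X \<pi>) B \<longleftrightarrow>
     B \<subseteq> \<pi> ` topspace X \<and> openin X {x \<in> topspace X. \<pi> x \<in> B}"
  unfolding quotient_topology_def by (simp add: istopology_quotient_topology)

lemma quotient_map_quotient_topology: "quotient_map X (quotient_topology X \<pi>) \<pi>"
proof -
  have "topspace (quotient_topology X \<pi>) = \<pi> ` topspace X"
  proof
    show "topspace (quotient_topology X \<pi>) \<subseteq> \<pi> ` topspace X"
      by (metis openin_quotient_topology openin_topspace)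
    have "{x \<in> topspace X. \<pi> x \<in> \<pi> ` topspace X} = topspace X" by auto
    then have "openin (quotient_topology X \<pi>) (\<pi> ` topspace X)"
      by (simp add: openin_quotient_topology)
    then show "\<pi> ` topspace X \<subseteq> topspace (quotient_topology X \<pi>)"
      by (rule openin_subset)
  qed
  then show ?thesis
    by (auto simp: quotient_map_def openin_quotient_topology)
qed

text \<open>
  The charts of a quotient by a local homeomorphism \<open>\<pi>\<close>: charts of \<open>X\<close> composed with local inverses
  of \<open>\<pi>\<close>. They give the quotient the smooth structure for which \<open>\<pi>\<close> is a submersion (here, as the
  dimensions agree, a local diffeomorphism), and they send a foliated atlas to one of the induced foliation.
\<close>

definition quotient_charts :: "'a topology \<Rightarrow> 'a chart set \<Rightarrow> ('a \<Rightarrow> 'b) \<Rightarrow> 'b chart set" where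
  "quotient_charts X A \<pi> =
     {(\<pi> ` Q, \<phi> \<circ> inv_into Q \<pi>) | U \<phi> Q. (U, \<phi>) \<in> A \<and> openin X Q \<and> Q \<subseteq> U \<and> inj_on \<pi> Q}"

definition M_topology :: "'a topology \<Rightarrow> (nat \<Rightarrow> 'a \<rightharpoonup> 'a) \<Rightarrow> ('a \<times> real \<times> real) set topology" where
  "M_topology N \<psi> = quotient_topology (W_topology N \<psi>) (M_proj (topspace N) \<psi>)"

definition M_charts ::
    "nat \<Rightarrow> 'a topology \<Rightarrow> 'a chart set \<Rightarrow> (nat \<Rightarrow> 'a \<rightharpoonup> 'a) \<Rightarrow> ('a \<times> real \<times> real) set chart set" where
  "M_charts n N A \<psi> = quotient_charts (W_topology N \<psi>) (W_charts n N A \<psi>) (M_proj (topspace N) \<psi>)"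


section \<open>Metrics and Riemannian foliations\<close>

definition bilinear_form :: "nat \<Rightarrow> (nat \<Rightarrow> nat \<Rightarrow> real) \<Rightarrow> (nat \<Rightarrow> real) \<Rightarrow> (nat \<Rightarrow> real) \<Rightarrow> real" where
  "bilinear_form n G v w = (\<Sum>i<n. \<Sum>j<n. G i j * v i * w j)"

definition pullback ::
    "nat \<Rightarrow> ((nat \<Rightarrow> real) \<Rightarrow> nat \<Rightarrow> real) \<Rightarrow> ((nat \<Rightarrow> real) \<Rightarrow> nat \<Rightarrow> nat \<Rightarrow> real) \<Rightarrow>
     (nat \<Rightarrow> real) \<Rightarrow> nat \<Rightarrow> nat \<Rightarrow> real" where
  "pullback n f h x a b =
     (\<Sum>k<n. \<Sum>l<n. pd a (\<lambda>y. f y k) x * pd b (\<lambda>y. f y l) x * h (f x) k l)"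

definition riemannian_metric ::
    "nat \<Rightarrow> (nat \<Rightarrow> real) set \<Rightarrow> ((nat \<Rightarrow> real) \<Rightarrow> nat \<Rightarrow> nat \<Rightarrow> real) \<Rightarrow> bool" where
  "riemannian_metric n V h \<longleftrightarrow>
     (\<forall>a<n. \<forall>b<n. smooth n V (\<lambda>x. h x a b)) \<and>
     (\<forall>x\<in>V. (\<forall>a<n. \<forall>b<n. h x a b = h x b a) \<and>
        (\<forall>v. (\<exists>a<n. v a \<noteq> 0) \<longrightarrow> 0 < bilinear_form n (h x) v v))"

definition acts_by_isometries ::
    "nat \<Rightarrow> ((nat \<Rightarrow> real) \<Rightarrow> nat \<Rightarrow> real) set \<Rightarrow> (nat \<Rightarrow> real) set \<Rightarrow>
     ((nat \<Rightarrow> real) \<Rightarrow> nat \<Rightarrow> nat \<Rightarrow> real) \<Rightarrow> bool" where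
  "acts_by_isometries n \<Gamma> V h \<longleftrightarrow>
     (\<forall>\<gamma>\<in>\<Gamma>. \<forall>x\<in>V. \<forall>a<n. \<forall>b<n. pullback n \<gamma> h x a b = h x a b)"

text \<open>
  For a transition \<open>\<psi>\<close> of the disjoint union, with the metric \<open>h i\<close> on the piece \<open>V i\<close>: near \<open>(i, x)\<close>
  the map \<open>\<psi>\<close> takes values in a single piece, and \<open>f\<close> is its expression as a map between the pieces.
\<close>

definition local_isometry ::
    "nat \<Rightarrow> ('i \<Rightarrow> (nat \<Rightarrow> real) \<Rightarrow> nat \<Rightarrow> nat \<Rightarrow> real) \<Rightarrow>
     ('i \<times> (nat \<Rightarrow> real) \<rightharpoonup> 'i \<times> (nat \<Rightarrow> real)) \<Rightarrow> bool" where
  "local_isometry n h \<psi> \<longleftrightarrow>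
     (\<forall>(i, x)\<in>dom \<psi>. let j = fst (the (\<psi> (i, x))); f = (\<lambda>y. snd (the (\<psi> (i, y)))) in
        \<forall>a<n. \<forall>b<n. pullback n f (h j) x a b = h i x a b)"

text \<open>
  Tensor fields are given by their components in the charts of an atlas, as functions of the
  coordinates, subject to the transformation law.
\<close>

definition tensor_field_02 ::
    "nat \<Rightarrow> 'a chart set \<Rightarrow> ('a chart \<Rightarrow> (nat \<Rightarrow> real) \<Rightarrow> nat \<Rightarrow> nat \<Rightarrow> real) \<Rightarrow> bool" where
  "tensor_field_02 n A g \<longleftrightarrow>
     (\<forall>c\<in>A. \<forall>i<n. \<forall>j<n. smooth n (chart_image c) (\<lambda>y. g c y i j)) \<and>
     (\<forall>c\<in>A. \<forall>c'\<in>A. \<forall>y\<in>snd c ` (fst c \<inter> fst c'). \<forall>i<n. \<forall>j<n.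
        g c y i j = pullback n (coord_change c c') (g c') y i j)"

definition vector_field ::
    "nat \<Rightarrow> 'a chart set \<Rightarrow> ('a chart \<Rightarrow> (nat \<Rightarrow> real) \<Rightarrow> nat \<Rightarrow> real) \<Rightarrow> bool" where
  "vector_field n A Y \<longleftrightarrow>
     (\<forall>c\<in>A. \<forall>i<n. smooth n (chart_image c) (\<lambda>y. Y c y i)) \<and>
     (\<forall>c\<in>A. \<forall>c'\<in>A. \<forall>y\<in>snd c ` (fst c \<inter> fst c'). \<forall>k<n.
        Y c' (coord_change c c' y) k = (\<Sum>i<n. pd i (\<lambda>z. coord_change c c' z k) y * Y c y i))"

text \<open>In a foliated chart, a vector is tangent to the leaves iff its transverse components vanish.\<close>

definition leaf_vector :: "nat \<Rightarrow> (nat \<Rightarrow> real) \<Rightarrow> bool" where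
  "leaf_vector q v \<longleftrightarrow> (\<forall>k<q. v k = 0)"

definition lie_derivative ::
    "nat \<Rightarrow> ((nat \<Rightarrow> real) \<Rightarrow> nat \<Rightarrow> real) \<Rightarrow> ((nat \<Rightarrow> real) \<Rightarrow> nat \<Rightarrow> nat \<Rightarrow> real) \<Rightarrow>
     (nat \<Rightarrow> real) \<Rightarrow> nat \<Rightarrow> nat \<Rightarrow> real" where
  "lie_derivative n Y g y i j =
     (\<Sum>k<n. Y y k * pd k (\<lambda>z. g z i j) y + g y k j * pd i (\<lambda>z. Y z k) y + g y i k * pd j (\<lambda>z. Y z k) y)"

definition transversely_riemannian_metric ::
    "nat \<Rightarrow> nat \<Rightarrow> 'a chart set \<Rightarrow> ('a chart \<Rightarrow> (nat \<Rightarrow> real) \<Rightarrow> nat \<Rightarrow> nat \<Rightarrow> real) \<Rightarrow> bool" where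
  "transversely_riemannian_metric n q A g \<longleftrightarrow>
     tensor_field_02 n A g \<and>
     (\<forall>c\<in>A. \<forall>y\<in>chart_image c.
        (\<forall>i<n. \<forall>j<n. g c y i j = g c y j i) \<and>
        (\<forall>v. 0 \<le> bilinear_form n (g c y) v v) \<and>
        \<comment> \<open>the form descends to the quotient by the leaf directions and is positive definite there\<close>
        (\<forall>v w. leaf_vector q v \<longrightarrow> bilinear_form n (g c y) v w = 0) \<and>
        (\<forall>v. \<not> leaf_vector q v \<longrightarrow> 0 < bilinear_form n (g c y) v v)) \<and>
     (\<forall>Y. vector_field n A Y \<and> (\<forall>c\<in>A. \<forall>y\<in>chart_image c. leaf_vector q (Y c y)) \<longrightarrow>
        (\<forall>c\<in>A. \<forall>y\<in>chart_image c. \<forall>j<n. (\<Sum>i<n. Y c y i * g c y i j) = 0) \<and>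
        (\<forall>c\<in>A. \<forall>y\<in>chart_image c. \<forall>i<n. \<forall>j<n. lie_derivative n (Y c) (g c) y i j = 0))"

definition riemannian_foliation :: "nat \<Rightarrow> nat \<Rightarrow> 'a topology \<Rightarrow> 'a chart set \<Rightarrow> bool" where
  "riemannian_foliation n q X A \<longleftrightarrow>
     foliated_manifold n q X A \<and> (\<exists>g. transversely_riemannian_metric n q A g)"

end

theory Submission
  imports Defs
begin

text \<open>
  Every equivalence class in \<open>W\<close> has at most two points, which differ by \<open>\<plusminus>2\<close> in the last coordinate, so
  the quotient map is open and injective on each piece of \<open>W\<close> whose last coordinate varies by less
  than 2; this gives the charts of \<open>M\<close>, and it also makes \<open>M\<close> Hausdorff, since every class has a
  representative with last coordinate in \<open>(0, 2]\<close>. Locally, every coordinate change of \<open>M\<close> has the form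
  \<open>(x, s, t) \<mapsto> (F x, s, t + d)\<close>, where \<open>F\<close> is the coordinate expression of the identity, of a generator, or
  of the inverse of a generator. As these are isometries, the metrics on the \<open>V i\<close>, extended by zero to the
  directions of \<open>s\<close> and \<open>t\<close>, agree on overlaps. The resulting tensor is constant along the leaves and
  annihilates their tangent vectors, hence its Lie derivatives along them vanish.
\<close>

section \<open>Functions on open subsets of Cartesian spaces\<close>

text \<open>The constants of the construction keep the classes small. A gluing starts at a height t
  in (2, 3) and ends in (0, 1), so gluings never chain, and the disjoint intervals (i, i + 1) for s
  reveal which generator acted. Hence no composite of generators ever enters a coordinate change,
  although the pseudogroup contains them all. The open ends 0 and 3 matter too: as t tends to 2 or
  3, one member of a glued pair leaves W, so such pairs do not converge to two distinct points of M.
  The remaining obstacle is that two charts of M may overlap in several regions, related by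
  different generators and different shifts d. No single formula then describes the coordinate
  change, so smoothness, plaques and the transformation law are all verified near one point at a
  time. There, a map already known to be smooth is combined only with the projection to the
  transverse coordinates and with translations, so no general chain rule is involved.\<close>

lemma continuous_map_cart_component: "continuous_map (Euclidean_space m) euclideanreal (\<lambda>x. x i)"
  unfolding Euclidean_space_def
  by (intro continuous_map_from_subtopology continuous_map_product_projection) auto

text \<open>Coordinates from \<open>n\<close> on vanish in \<open>cart n\<close>, so
  \<open>f\<close> agrees with its truncation, for which continuity is componentwise.\<close>

lemma continuous_map_into_cart:
  assumes "\<And>i. i < n \<Longrightarrow> continuous_map X euclideanreal (\<lambda>x. f x i)"
    and "\<And>x. x \<in> topspace X \<Longrightarrow> f x \<in> cart n"
  shows "continuous_map X (Euclidean_space n) f"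
proof (rule continuous_map_eq)
  show "continuous_map X (Euclidean_space n) (\<lambda>x i. if i < n then f x i else 0)"
    using assms(1) by (simp add: continuous_map_componentwise_Euclidean_space)
  show "(\<lambda>i. if i < n then f x i else 0) = f x" if "x \<in> topspace X" for x
    using assms(2)[OF that] by (auto simp: topspace_Euclidean_space fun_eq_iff)
qed

lemma fun_upd_in_cart: "x \<in> cart n \<Longrightarrow> i < n \<Longrightarrow> x(i := t) \<in> cart n"
  by (auto simp: topspace_Euclidean_space)

text \<open>Partial derivatives are one-variable derivatives along coordinate lines. This turns
  openness of \<open>U\<close> into a neighbourhood of parameters, so that \<open>pd\<close> depends
  only on the germ of a function.\<close>

lemma eventually_line:
  assumes "openin (Euclidean_space n) U" "x \<in> U" "i < n"
  shows "\<forall>\<^sub>F t in nhds (x i). x(i := t) \<in> U"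
proof -
  have x: "x \<in> cart n" using assms openin_subset by blast
  have "continuous_map euclideanreal euclideanreal (\<lambda>t. (x(i := t)) j)" for j
    by (cases "j = i") auto
  then have "continuous_map euclideanreal (Euclidean_space n) (\<lambda>t. x(i := t))"
    using fun_upd_in_cart[OF x assms(3)] by (intro continuous_map_into_cart) auto
  then have "openin euclideanreal {t \<in> topspace euclideanreal. x(i := t) \<in> U}"
    using assms(1) openin_continuous_map_preimage by blast
  then show ?thesis
    using assms(2) by (auto simp: eventually_nhds fun_upd_triv intro!: exI[of _ "{t. x(i := t) \<in> U}"])
qed

lemma pd_cong:
  assumes "openin (Euclidean_space n) U" "x \<in> U" "i < n" "\<And>y. y \<in> U \<Longrightarrow> f y = g y"
  shows "pd i f x = pd i g x"
  unfolding pd_def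
  by (rule deriv_cong_ev[OF eventually_mono[OF eventually_line[OF assms(1-3)]]]) (use assms in auto)

lemma pd_const: "pd i (\<lambda>y. c) = (\<lambda>y. 0)"
  by (simp add: pd_def fun_eq_iff)

lemma pd_component_add: "pd i (\<lambda>y. y k + c) = (\<lambda>y. if i = k then 1 else 0)"
proof
  fix y :: "nat \<Rightarrow> real"
  have "((\<lambda>t. t + c) has_field_derivative 1) (at (y i))"
    by (auto intro!: derivative_eq_intros)
  then show "pd i (\<lambda>y. y k + c) y = (if i = k then 1 else 0)"
    by (auto simp: pd_def DERIV_imp_deriv)
qed

text \<open>Derivatives of \<open>f\<close> require agreement near \<open>x\<close>, whereas the
  form is evaluated only at the image point; hence the pointwise premise on
  \<open>h\<close>.\<close>

lemma pullback_cong: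
  assumes "openin (Euclidean_space n) U" "x \<in> U" "\<And>y k. y \<in> U \<Longrightarrow> k < n \<Longrightarrow> f y k = f' y k"
    and "\<And>k l. k < n \<Longrightarrow> l < n \<Longrightarrow> h (f x) k l = h' (f' x) k l" "a < n" "b < n"
  shows "pullback n f h x a b = pullback n f' h' x a b"
  unfolding pullback_def
  by (intro sum.cong refl arg_cong2[where f = times] pd_cong[OF assms(1,2)]) (use assms in auto)

section \<open>Restriction and locality of smoothness\<close>

lemma Ck_subset: "Ck k n U f \<Longrightarrow> S \<subseteq> U \<Longrightarrow> Ck k n S f"
proof (induction k arbitrary: f)
  case (Suc k)
  then have "\<And>i. i < n \<Longrightarrow> Ck k n S (pd i f)" by simp
  with Suc.prems show ?case
    by (auto intro: continuous_map_from_subtopology_mono)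
qed (auto intro: continuous_map_from_subtopology_mono)

lemma continuous_map_locally:
  assumes "\<And>x. x \<in> topspace X \<Longrightarrow> \<exists>Q g. openin X Q \<and> x \<in> Q \<and> (\<forall>y\<in>Q. f y = g y) \<and>
    continuous_map (subtopology X Q) Y g"
  shows "continuous_map X Y f"
  unfolding continuous_map_alt
proof (intro conjI allI impI)
  show "f \<in> topspace X \<rightarrow> topspace Y"
  proof
    fix x assume "x \<in> topspace X"
    then show "f x \<in> topspace Y"
      using assms[of x] by (auto simp: continuous_map_def)
  qed
next
  fix B assume B: "openin Y B"
  show "openin X (f -` B \<inter> topspace X)"
  proof (subst openin_subopen, intro ballI)
    fix x assume x: "x \<in> f -` B \<inter> topspace X"
    obtain Q g where Q: "openin X Q" "x \<in> Q" "\<And>y. y \<in> Q \<Longrightarrow> f y = g y"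
        "continuous_map (subtopology X Q) Y g"
      using assms[of x] x by blast
    let ?T = "{y \<in> topspace (subtopology X Q). g y \<in> B}"
    have "openin X ?T"
      using openin_continuous_map_preimage[OF Q(4) B] Q(1) openin_trans_full by blast
    moreover have "x \<in> ?T" "?T \<subseteq> f -` B \<inter> topspace X"
      using x Q openin_subset by auto
    ultimately show "\<exists>T. openin X T \<and> x \<in> T \<and> T \<subseteq> f -` B \<inter> topspace X"
      by blast
  qed
qed

lemma Ck_imp_continuous: "Ck k n U f \<Longrightarrow> continuous_map (subtopology (Euclidean_space n) U) euclideanreal f"
  by (cases k) auto

text \<open>Lets a map be differentiated through formulas that vary from point to point, as happens
  for the coordinate changes of the quotient. The induction goes through because \<open>pd\<close>
  sees only germs, so the partial derivatives again have local representatives.\<close>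

lemma Ck_locally:
  assumes "\<And>x. x \<in> U \<Longrightarrow> \<exists>Q g. openin (Euclidean_space n) Q \<and> x \<in> Q \<and> Q \<subseteq> U \<and> (\<forall>y\<in>Q. f y = g y) \<and> Ck k n Q g"
  shows "Ck k n U f"
  using assms
proof (induction k arbitrary: f)
  have cont: "continuous_map (subtopology (Euclidean_space n) U) euclideanreal f"
    if *: "\<And>x. x \<in> U \<Longrightarrow> \<exists>Q g. openin (Euclidean_space n) Q \<and> x \<in> Q \<and> Q \<subseteq> U \<and> (\<forall>y\<in>Q. f y = g y) \<and> Ck k n Q g"
    for f k
  proof (rule continuous_map_locally)
    fix x assume "x \<in> topspace (subtopology (Euclidean_space n) U)"
    then obtain Q g where Q: "openin (Euclidean_space n) Q" "x \<in> Q" "Q \<subseteq> U" "\<forall>y\<in>Q. f y = g y"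
        "Ck k n Q g"
      using *[of x] by auto
    moreover have "openin (subtopology (Euclidean_space n) U) Q"
      using Q by (auto simp: openin_subtopology)
    moreover have "continuous_map (subtopology (subtopology (Euclidean_space n) U) Q) euclideanreal g"
      using Ck_imp_continuous[OF Q(5)] Q(3) by (simp add: subtopology_subtopology inf.absorb2)
    ultimately show "\<exists>Q g. openin (subtopology (Euclidean_space n) U) Q \<and> x \<in> Q \<and> (\<forall>y\<in>Q. f y = g y) \<and>
        continuous_map (subtopology (subtopology (Euclidean_space n) U) Q) euclideanreal g"
      by blast
  qed
  {
    case 0
    then show ?case using cont[of f 0] by simp
  next
    case (Suc k)
    have "(\<lambda>t. f (x(i := t))) differentiable (at (x i))" if i: "i < n" and x: "x \<in> U" for i x
    proof -
      obtain Q g where Q: "openin (Euclidean_space n) Q" "x \<in> Q" "\<And>y. y\<in>Q \<Longrightarrow> f y = g y" "Ck (Suc k) n Q g"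
        using Suc.prems[OF x] by blast
      obtain D where "((\<lambda>t. g (x(i := t))) has_real_derivative D) (at (x i))"
        using Q(2,4) i unfolding Ck.simps real_differentiable_def by blast
      moreover have "\<forall>\<^sub>F t in nhds (x i). f (x(i := t)) = g (x(i := t))"
        by (rule eventually_mono[OF eventually_line[OF Q(1,2) i]]) (use Q in auto)
      ultimately have "((\<lambda>t. f (x(i := t))) has_real_derivative D) (at (x i))"
        by (subst DERIV_cong_ev[OF refl _ refl]) auto
      then show ?thesis by (auto simp: real_differentiable_def)
    qed
    moreover have "Ck k n U (pd i f)" if i: "i < n" for i
    proof (rule Suc.IH)
      fix x assume x: "x \<in> U"
      then obtain Q g where Q: "openin (Euclidean_space n) Q" "x \<in> Q" "Q \<subseteq> U" "\<And>y. y\<in>Q \<Longrightarrow> f y = g y"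
          "Ck (Suc k) n Q g"
        using Suc.prems[OF x] by blast
      then have "Ck k n Q (pd i g)" "\<forall>y\<in>Q. pd i f y = pd i g y"
        using i pd_cong[OF Q(1) _ i Q(4)] by auto
      then show "\<exists>Q g. openin (Euclidean_space n) Q \<and> x \<in> Q \<and> Q \<subseteq> U \<and> (\<forall>y\<in>Q. pd i f y = g y) \<and> Ck k n Q g"
        using Q by blast
    qed
    ultimately show ?case
      using cont[OF Suc.prems] by simp
  }
qed

lemma smooth_locally:
  assumes "\<And>x. x \<in> U \<Longrightarrow> \<exists>Q g. openin (Euclidean_space n) Q \<and> x \<in> Q \<and> Q \<subseteq> U \<and> (\<forall>y\<in>Q. f y = g y) \<and> smooth n Q g"
  shows "smooth n U f"
  unfolding smooth_def
proof
  fix k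
  show "Ck k n U f"
  proof (rule Ck_locally)
    fix x assume "x \<in> U"
    then obtain Q g where "openin (Euclidean_space n) Q" "x \<in> Q" "Q \<subseteq> U" "\<forall>y\<in>Q. f y = g y" "smooth n Q g"
      using assms by blast
    then show "\<exists>Q g. openin (Euclidean_space n) Q \<and> x \<in> Q \<and> Q \<subseteq> U \<and> (\<forall>y\<in>Q. f y = g y) \<and> Ck k n Q g"
      unfolding smooth_def by (intro exI[of _ Q] exI[of _ g]) simp
  qed
qed

lemma smooth_subset: "smooth n U f \<Longrightarrow> S \<subseteq> U \<Longrightarrow> smooth n S f"
  by (auto simp: smooth_def intro: Ck_subset)

lemma Ck_const: "Ck k n U (\<lambda>y. c)"
  by (induction k arbitrary: c) (auto simp: pd_const)

lemma smooth_const: "smooth n U (\<lambda>y. c)"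
  by (simp add: smooth_def Ck_const)

lemma smooth_component_add: "smooth n U (\<lambda>y. y j + c)"
  unfolding smooth_def
proof
  fix k
  have cont: "continuous_map (subtopology (Euclidean_space n) U) euclideanreal (\<lambda>y. y j + c)"
    by (intro continuous_intros continuous_map_from_subtopology continuous_map_cart_component)
  have "(\<lambda>t. (x(i := t)) j + c) differentiable at (x i)" for x :: "nat \<Rightarrow> real" and i
    by (cases "i = j") auto
  then show "Ck k n U (\<lambda>y. y j + c)"
    using cont by (cases k) (simp_all add: pd_component_add Ck_const)
qed

section \<open>Projection to the first coordinates, and suspensions of maps\<close>

definition cart_proj :: "nat \<Rightarrow> (nat \<Rightarrow> real) \<Rightarrow> nat \<Rightarrow> real" where
  "cart_proj n y = (\<lambda>i. if i < n then y i else 0)"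

lemma cart_proj_in_cart [simp]: "cart_proj n y \<in> cart n"
  by (simp add: cart_proj_def topspace_Euclidean_space)

lemma cart_proj_upd: "cart_proj n (y(i := t)) = (if i < n then (cart_proj n y)(i := t) else cart_proj n y)"
  by (auto simp: cart_proj_def)

lemma continuous_map_cart_proj: "continuous_map (Euclidean_space m) (Euclidean_space n) (cart_proj n)"
  by (rule continuous_map_into_cart) (auto simp: cart_proj_def topspace_Euclidean_space continuous_map_cart_component)

lemma pd_cart_proj: "pd i (\<lambda>y. f (cart_proj n y)) = (\<lambda>y. if i < n then pd i f (cart_proj n y) else 0)"
proof
  fix y
  show "pd i (\<lambda>y. f (cart_proj n y)) y = (if i < n then pd i f (cart_proj n y) else 0)"
    by (simp add: pd_def cart_proj_upd) (simp add: cart_proj_def)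
qed

text \<open>Along a line in a direction \<open>i < n\<close> the composite is \<open>f\<close> along
  the projected line, and along any other coordinate line it is constant. Partial derivatives
  therefore have the same shape or vanish, and the induction closes without a chain rule.\<close>

lemma Ck_cart_proj:
  assumes "Ck k n U f"
  shows "Ck k m {y \<in> cart m. cart_proj n y \<in> U} (\<lambda>y. f (cart_proj n y))"
  using assms
proof (induction k arbitrary: f)
  let ?U = "{y \<in> cart m. cart_proj n y \<in> U}"
  have cont: "continuous_map (subtopology (Euclidean_space m) ?U) euclideanreal (\<lambda>y. f (cart_proj n y))"
    if "Ck k n U f" for k f
  proof -
    have "continuous_map (subtopology (Euclidean_space m) ?U) (subtopology (Euclidean_space n) U) (cart_proj n)"
      by (auto simp: continuous_map_in_subtopology intro: continuous_map_from_subtopology continuous_map_cart_proj)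
    then show ?thesis
      using continuous_map_compose[OF _ Ck_imp_continuous[OF that], of _ "cart_proj n"] by (simp add: o_def)
  qed
  {
    case 0
    then show ?case using cont[of 0 f] by simp
  next
    case (Suc k)
    have "(\<lambda>t. f (cart_proj n (x(i := t)))) differentiable at (x i)" if "x \<in> ?U" for x i
    proof (cases "i < n")
      case True
      then have "(\<lambda>t. f ((cart_proj n x)(i := t))) differentiable at (cart_proj n x i)"
        using Suc.prems that by auto
      then show ?thesis using True by (simp add: cart_proj_upd) (simp add: cart_proj_def)
    qed (simp add: cart_proj_upd)
    moreover have "Ck k m ?U (pd i (\<lambda>y. f (cart_proj n y)))" for i
      using Suc.IH[of "pd i f"] Suc.prems unfolding pd_cart_proj by (cases "i < n") (simp_all add: Ck_const)
    ultimately show ?case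
      using cont[OF Suc.prems] by simp
  }
qed

lemma smooth_cart_proj:
  "smooth n U f \<Longrightarrow> smooth m {y \<in> cart m. cart_proj n y \<in> U} (\<lambda>y. f (cart_proj n y))"
  by (simp add: smooth_def Ck_cart_proj)

lemma smooth_map_subset: "smooth_map m n U f \<Longrightarrow> S \<subseteq> U \<Longrightarrow> smooth_map m n S f"
  unfolding smooth_map_def by (meson image_mono order_trans smooth_subset)

lemma smooth_map_locally:
  assumes "\<And>x. x \<in> U \<Longrightarrow> \<exists>Q g. openin (Euclidean_space m) Q \<and> x \<in> Q \<and> Q \<subseteq> U \<and> (\<forall>y\<in>Q. f y = g y) \<and> smooth_map m n Q g"
  shows "smooth_map m n U f"
  unfolding smooth_map_def
proof (intro conjI allI impI subsetI)
  fix y assume "y \<in> f ` U"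
  then obtain x where "x \<in> U" "y = f x" by blast
  then show "y \<in> cart n"
    using assms[of x] unfolding smooth_map_def by force
next
  fix k assume k: "k < n"
  show "smooth m U (\<lambda>x. f x k)"
  proof (rule smooth_locally)
    fix x assume "x \<in> U"
    then obtain Q g where "openin (Euclidean_space m) Q" "x \<in> Q" "Q \<subseteq> U" "\<forall>y\<in>Q. f y = g y" "smooth_map m n Q g"
      using assms by blast
    then show "\<exists>Q g. openin (Euclidean_space m) Q \<and> x \<in> Q \<and> Q \<subseteq> U \<and> (\<forall>y\<in>Q. f y k = g y) \<and> smooth m Q g"
      using k by (intro exI[of _ Q] exI[of _ "\<lambda>x. g x k"]) (simp add: smooth_map_def)
  qed
qed

lemma cart_upd2: "y \<in> cart n \<Longrightarrow> y(n := s, n + 1 := t) \<in> cart (n + 2)"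
  by (auto simp: topspace_Euclidean_space)

lemma cart_proj_upd2: "y \<in> cart n \<Longrightarrow> cart_proj n (y(n := s, n + 1 := t)) = y"
  by (auto simp: topspace_Euclidean_space cart_proj_def)

lemma cart_proj_upd2_id: "z \<in> cart (n + 2) \<Longrightarrow> (cart_proj n z)(n := z n, n + 1 := z (n + 1)) = z"
proof
  fix i assume "z \<in> cart (n + 2)"
  then show "((cart_proj n z)(n := z n, n + 1 := z (n + 1))) i = z i"
    by (cases "i < n"; cases "i = n"; cases "i = n + 1") (auto simp: topspace_Euclidean_space cart_proj_def)
qed

text \<open>Every component is either a component of \<open>F\<close> composed with the projection
  or a coordinate plus a constant: 0 for s, and \<open>d\<close> for t.\<close>

lemma smooth_map_suspension:
  assumes "smooth_map n n G F"
  shows "smooth_map (n + 2) (n + 2) {z \<in> cart (n + 2). cart_proj n z \<in> G}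
    (\<lambda>z. (F (cart_proj n z))(n := z n, n + 1 := z (n + 1) + d))"
  unfolding smooth_map_def
proof (intro conjI allI impI)
  have "F y \<in> cart n" if "y \<in> G" for y using assms that by (auto simp: smooth_map_def)
  then show "(\<lambda>z. (F (cart_proj n z))(n := z n, n + 1 := z (n + 1) + d)) ` {z \<in> cart (n + 2). cart_proj n z \<in> G}
      \<subseteq> cart (n + 2)"
    using cart_upd2 by blast
  fix k assume "k < n + 2"
  let ?S = "smooth (n + 2) {z \<in> cart (n + 2). cart_proj n z \<in> G}"
  consider "k < n" | "k = n" | "k = n + 1" using \<open>k < n + 2\<close> by linarith
  then show "?S (\<lambda>x. ((F (cart_proj n x))(n := x n, n + 1 := x (n + 1) + d)) k)"
  proof cases
    case 1
    then have "smooth n G (\<lambda>y. F y k)" using assms by (simp add: smooth_map_def)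
    from smooth_cart_proj[OF this] show ?thesis using 1 by simp
  qed (use smooth_component_add[of _ _ _ 0] smooth_component_add in auto)
qed

lemma pd_suspension:
  assumes "k < n"
  shows "pd a (\<lambda>z. ((F (cart_proj n z))(n := z n, n + 1 := z (n + 1) + d)) k) y =
    (if a < n then pd a (\<lambda>x. F x k) (cart_proj n y) else 0)"
  using assms pd_cart_proj[of a "\<lambda>x. F x k" n] by (simp add: fun_eq_iff)

section \<open>Second countability\<close>

lemma second_countable_euclidean: "second_countable (euclidean :: 'a :: second_countable_topology topology)"
proof -
  obtain B :: "'a set set" where B: "countable B" "\<And>b. b \<in> B \<Longrightarrow> open b" "\<And>S. open S \<Longrightarrow> \<exists>U. U \<subseteq> B \<and> S = \<Union>U"
    by (rule univ_second_countable) auto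
  show ?thesis
    unfolding second_countable_def
  proof (intro exI[of _ B] conjI allI impI ballI)
    fix S and x :: 'a
    assume "openin euclidean S \<and> x \<in> S"
    then show "\<exists>V\<in>B. x \<in> V \<and> V \<subseteq> S"
      using B(3)[of S] by auto
  qed (use B in auto)
qed

lemma second_countable_prod_topology:
  assumes "second_countable X" "second_countable Y"
  shows "second_countable (prod_topology X Y)"
proof -
  obtain B where B: "countable B" "\<And>b. b \<in> B \<Longrightarrow> openin X b"
    "\<And>S x. openin X S \<Longrightarrow> x \<in> S \<Longrightarrow> \<exists>V\<in>B. x \<in> V \<and> V \<subseteq> S"
    using assms(1) unfolding second_countable_def by auto
  obtain C where C: "countable C" "\<And>b. b \<in> C \<Longrightarrow> openin Y b"
    "\<And>S x. openin Y S \<Longrightarrow> x \<in> S \<Longrightarrow> \<exists>V\<in>C. x \<in> V \<and> V \<subseteq> S"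
    using assms(2) unfolding second_countable_def by auto
  show ?thesis
    unfolding second_countable_def
  proof (intro exI[of _ "(\<lambda>(b, c). b \<times> c) ` (B \<times> C)"] conjI allI impI ballI)
    show "countable ((\<lambda>(b, c). b \<times> c) ` (B \<times> C))"
      using B(1) C(1) by simp
    show "openin (prod_topology X Y) V" if "V \<in> (\<lambda>(b, c). b \<times> c) ` (B \<times> C)" for V
      using that B(2) C(2) by (auto simp: openin_prod_Times_iff)
    fix S z assume Sz: "openin (prod_topology X Y) S \<and> z \<in> S"
    obtain x y where z: "z = (x, y)" by (cases z)
    with Sz obtain G H where GH: "openin X G" "openin Y H" "x \<in> G" "y \<in> H" "G \<times> H \<subseteq> S"
      unfolding openin_prod_topology_alt by blast
    obtain b c where "b \<in> B" "x \<in> b" "b \<subseteq> G" "c \<in> C" "y \<in> c" "c \<subseteq> H"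
      using B(3)[OF GH(1,3)] C(3)[OF GH(2,4)] by blast
    then show "\<exists>V\<in>(\<lambda>(b, c). b \<times> c) ` (B \<times> C). z \<in> V \<and> V \<subseteq> S"
      using z GH(5) by (intro bexI[of _ "b \<times> c"]) auto
  qed
qed

lemma second_countable_sum_topology:
  assumes "countable I" "\<And>i. i \<in> I \<Longrightarrow> second_countable (X i)"
  shows "second_countable (sum_topology X I)"
proof -
  have "\<forall>i\<in>I. \<exists>B. countable B \<and> (\<forall>b\<in>B. openin (X i) b) \<and>
      (\<forall>S x. openin (X i) S \<and> x \<in> S \<longrightarrow> (\<exists>V\<in>B. x \<in> V \<and> V \<subseteq> S))"
    using assms(2) unfolding second_countable_def by auto
  then obtain B where B: "\<And>i. i \<in> I \<Longrightarrow> countable (B i)" "\<And>i b. i \<in> I \<Longrightarrow> b \<in> B i \<Longrightarrow> openin (X i) b"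
    "\<And>i S x. i \<in> I \<Longrightarrow> openin (X i) S \<Longrightarrow> x \<in> S \<Longrightarrow> \<exists>V\<in>B i. x \<in> V \<and> V \<subseteq> S"
    by metis
  show ?thesis
    unfolding second_countable_def
  proof (intro exI[of _ "\<Union>i\<in>I. (\<lambda>b. Pair i ` b) ` B i"] conjI allI impI ballI)
    show "countable (\<Union>i\<in>I. (\<lambda>b. Pair i ` b) ` B i)"
      using assms(1) B(1) by auto
    show "openin (sum_topology X I) V" if "V \<in> (\<Union>i\<in>I. (\<lambda>b. Pair i ` b) ` B i)" for V
      using that B(2) open_map_component_injection[of _ I X] unfolding open_map_def by blast
    fix S z assume Sz: "openin (sum_topology X I) S \<and> z \<in> S"
    obtain i x where z: "z = (i, x)" by (cases z)
    with Sz have "i \<in> I" "openin (X i) {x. (i, x) \<in> S}" unfolding openin_sum_topology by auto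
    then obtain b where "b \<in> B i" "x \<in> b" "b \<subseteq> {x. (i, x) \<in> S}"
      using B(3)[of i "{x. (i, x) \<in> S}" x] Sz z by auto
    then show "\<exists>V\<in>(\<Union>i\<in>I. (\<lambda>b. Pair i ` b) ` B i). z \<in> V \<and> V \<subseteq> S"
      using z \<open>i \<in> I\<close> by (intro bexI[of _ "Pair i ` b"]) auto
  qed
qed

text \<open>The type \<open>nat \<Rightarrow> real\<close> is a countable product of second
  countable spaces, and \<open>Euclidean_space n\<close> is a subspace of it.\<close>

lemma second_countable_Euclidean_space: "second_countable (Euclidean_space n)"
  unfolding Euclidean_space_def euclidean_product_topology
  by (intro second_countable_subtopology second_countable_euclidean)

section \<open>The quotient map\<close>

text \<open>
  A triple \<open>(S, f, d)\<close> stands for the map \<open>(x, s, t) \<mapsto> (f x, s, t + d)\<close> with \<open>x \<in> S\<close>; equivalent points of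
  \<open>W\<close> are related by one of these, and the identity is included to avoid a case distinction.
\<close>

definition gluing_maps :: "'a topology \<Rightarrow> (nat \<Rightarrow> 'a \<rightharpoonup> 'a) \<Rightarrow> ('a set \<times> ('a \<Rightarrow> 'a) \<times> real) set" where
  "gluing_maps N \<psi> = insert (topspace N, id, 0)
     (\<Union>i\<in>{1..}. {(dom (\<psi> i), the \<circ> \<psi> i, -2), (ran (\<psi> i), the \<circ> partial_inverse (\<psi> i), 2)})"

definition gluing_shift :: "('a \<Rightarrow> 'a) \<Rightarrow> real \<Rightarrow> 'a \<times> real \<times> real \<Rightarrow> 'a \<times> real \<times> real" where
  "gluing_shift f d = (\<lambda>(x, s, t). (f x, s, t + d))"

lemma gluing_shift_simp [simp]: "gluing_shift f d (x, s, t) = (f x, s, t + d)"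
  by (simp add: gluing_shift_def)

lemma partial_inverse_eq_Some_iff:
  assumes "inj_on \<psi> (dom \<psi>)"
  shows "partial_inverse \<psi> y = Some x \<longleftrightarrow> \<psi> x = Some y"
proof -
  have uniq: "x' = x" if "\<psi> x = Some y" "\<psi> x' = Some y" for x x'
    using that assms by (metis domI inj_onD)
  have "(SOME x. \<psi> x = Some y) = x" if "\<psi> x = Some y" for x
    using someI[of "\<lambda>x. \<psi> x = Some y" x] that uniq by blast
  then show ?thesis
    by (auto simp: partial_inverse_def ran_def)
qed

text \<open>The construction of M for an arbitrary manifold and sequence of transitions; the
  quasifold enters only when the locale is interpreted.\<close>

locale gluing =
  fixes n :: nat and N :: "'a topology" and A :: "'a chart set" and \<psi> :: "nat \<Rightarrow> 'a \<rightharpoonup> 'a"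
  assumes manifold_N: "smooth_manifold n N A"
    and transition: "i \<ge> 1 \<Longrightarrow> transition n N A (\<psi> i)"
begin

abbreviation "W \<equiv> W_topology N \<psi>"
abbreviation "M \<equiv> M_topology N \<psi>"
abbreviation "\<pi> \<equiv> M_proj (topspace N) \<psi>"

lemma glue_inj: "i \<ge> 1 \<Longrightarrow> \<psi> i x = Some y \<Longrightarrow> \<psi> i x' = Some y \<Longrightarrow> x = x'"
  using transition[of i] unfolding transition_def by (metis domI inj_onD)

lemma partial_inverse_iff: "i \<ge> 1 \<Longrightarrow> partial_inverse (\<psi> i) y = Some x \<longleftrightarrow> \<psi> i x = Some y"
  using transition[of i] unfolding transition_def by (simp add: partial_inverse_eq_Some_iff)

lemma dom_ran_subset:
  assumes "i \<ge> 1" "\<psi> i x = Some y"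
  shows "x \<in> topspace N" "y \<in> topspace N"
  using transition[OF assms(1)] assms(2) unfolding transition_def
  by (meson domI ranI openin_subset subsetD)+

lemma topspace_W: "topspace W = W_set (topspace N) \<psi>"
  unfolding W_topology_def W_set_def using dom_ran_subset by fastforce

lemma mem_W: "(x, s, t) \<in> topspace W \<longleftrightarrow> x \<in> topspace N \<and> 0 < t \<and> t < 1 \<or>
    (\<exists>i\<ge>1. x \<in> dom (\<psi> i) \<and> real i < s \<and> s < real i + 1 \<and> 0 < t \<and> t < 3)"
  unfolding topspace_W W_set_def by auto

lemma topspace_W_bounds: "(x, s, t) \<in> topspace W \<Longrightarrow> x \<in> topspace N \<and> 0 < t \<and> t < 3"
  using dom_ran_subset by (fastforce simp: mem_W)

lemma openin_box:
  fixes S T :: "real set"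
  assumes "openin N G" "open S" "open T"
  shows "openin (prod_topology N euclidean) (G \<times> S \<times> T)"
  using assms by (simp add: openin_prod_Times_iff open_Times)

lemma openin_W: "openin W Q \<longleftrightarrow> openin (prod_topology N (prod_topology euclideanreal euclideanreal)) Q \<and> Q \<subseteq> topspace W"
proof -
  have "openin N (dom (\<psi> i))" if "i \<ge> 1" for i
    using transition[OF that] by (simp add: transition_def)
  then have "openin (prod_topology N (prod_topology euclideanreal euclideanreal)) (W_set (topspace N) \<psi>)"
    unfolding W_set_def by (intro openin_Un openin_Union) (auto intro: openin_box)
  then show ?thesis
    unfolding topspace_W unfolding W_topology_def by (simp add: openin_open_subtopology)
qed

lemma openin_W_box:
  assumes "openin N G" "open S" "open T" "G \<times> S \<times> T \<subseteq> topspace W"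
  shows "openin W (G \<times> S \<times> T)"
  using assms by (simp add: openin_W openin_box)

lemma continuous_map_W:
  shows "continuous_map W N fst" "continuous_map W euclideanreal (\<lambda>p. fst (snd p))"
    "continuous_map W euclideanreal (\<lambda>p. snd (snd p))"
  unfolding W_topology_def
  by (intro continuous_map_from_subtopology continuous_map_fst
      continuous_map_compose[OF continuous_map_snd continuous_map_fst, unfolded o_def]
      continuous_map_compose[OF continuous_map_snd continuous_map_snd, unfolded o_def])+

text \<open>For the identity this is the smoothness of the coordinate changes of \<open>A\<close>;
  for the other two kinds it is part of \<open>transition\<close>.\<close>

lemma gluing_map:
  assumes "(S, f, d) \<in> gluing_maps N \<psi>"
  shows "openin N S" "manifold_smooth n N A S n N A f"
proof -
  have "fst c \<inter> topspace N = fst c" if "c \<in> A" for c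
    using manifold_N that unfolding smooth_manifold_def by blast
  then have "manifold_smooth n N A (topspace N) n N A id"
    using manifold_N by (auto simp: manifold_smooth_def smooth_manifold_def coord_change_def Int_def)
  then show "openin N S" "manifold_smooth n N A S n N A f"
    using assms transition unfolding gluing_maps_def transition_def by auto
qed

section \<open>Classes of the gluing relation\<close>

lemma glue_D:
  assumes "W_glue \<psi> p p'"
  obtains i x y s t where "i \<ge> 1" "p = (x, s, t)" "p' = (y, s, t - 2)" "\<psi> i x = Some y"
    "real i < s" "s < real i + 1" "2 < t" "t < 3"
  using assms unfolding W_glue_def by blast

text \<open>The target has its last coordinate in \<open>(0, 1)\<close>, where \<open>W\<close>
  contains every point of \<open>N\<close>.\<close>

lemma glue_in_W:
  assumes "W_glue \<psi> p p'"
  shows "p \<in> topspace W" "p' \<in> topspace W"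
  using assms by (auto elim!: glue_D simp: mem_W dom_ran_subset intro!: exI conjI)

text \<open>When a walk is extended by one step, two consecutive steps in the same direction are
  excluded, while two steps with a common source or a common target lead back to the start. So a
  walk never gets further than one step.\<close>

lemma equivclp_glue: "equivclp (W_glue \<psi>) p p' \<longleftrightarrow> p = p' \<or> W_glue \<psi> p p' \<or> W_glue \<psi> p' p"
proof
  assume "equivclp (W_glue \<psi>) p p'"
  then show "p = p' \<or> W_glue \<psi> p p' \<or> W_glue \<psi> p' p"
  proof (induction rule: equivclp_induct)
    case (step q r)
    \<comment> \<open>A target lies below height 1 and a source above height 2.\<close>
    have 1: False if "W_glue \<psi> a b" "W_glue \<psi> b c" for a b c
      using that by (elim glue_D) auto
    have index: "j = i" if "real i < s" "s < real i + 1" "real j < s" "s < real j + 1" for i j s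
      using that by linarith
    \<comment> \<open>The common value of s forces the same generator, and a generator is a
      function; for a common target its injectivity takes over.\<close>
    have 2: "b = c" if "W_glue \<psi> a b" "W_glue \<psi> a c" for a b c
      using that by (elim glue_D) (auto dest: index)
    have 3: "a = c" if "W_glue \<psi> a b" "W_glue \<psi> c b" for a b c
      using that
    proof (elim glue_D)
      fix i j x x' y y' s s' t t'
      assume *: "1 \<le> i" "a = (x, s, t)" "b = (y, s, t - 2)" "\<psi> i x = Some y" "real i < s" "s < real i + 1"
        "1 \<le> j" "c = (x', s', t')" "b = (y', s', t' - 2)" "\<psi> j x' = Some y'" "real j < s'" "s' < real j + 1"
      then have "j = i" using index by auto
      then show "a = c" using * glue_inj[of i x y x'] by auto
    qed
    from step 1 2 3 show ?case by metis
  qed auto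
qed (auto intro: equivclp_sym)

lemma proj_eq_iff:
  assumes "p \<in> topspace W" "p' \<in> topspace W"
  shows "\<pi> p = \<pi> p' \<longleftrightarrow> p = p' \<or> W_glue \<psi> p p' \<or> W_glue \<psi> p' p"
proof -
  have "\<pi> p = \<pi> p' \<longleftrightarrow> equivclp (W_glue \<psi>) p p'"
  proof
    assume "\<pi> p = \<pi> p'"
    moreover have "p' \<in> \<pi> p'" using assms by (simp add: M_proj_def topspace_W)
    ultimately have "p' \<in> \<pi> p" by simp
    then show "equivclp (W_glue \<psi>) p p'" by (simp add: M_proj_def)
  next
    assume "equivclp (W_glue \<psi>) p p'"
    then show "\<pi> p = \<pi> p'"
      unfolding M_proj_def by (auto intro: equivclp_trans equivclp_sym)
  qed
  then show ?thesis by (simp add: equivclp_glue)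
qed

section \<open>Local form and openness of the quotient map\<close>

lemma quotient_map_proj: "quotient_map W M \<pi>"
  unfolding M_topology_def by (rule quotient_map_quotient_topology)

text \<open>Makes the three ways of being equivalent uniform: an identification of two points
  extends to a continuous map of the form \<open>gluing_shift f d\<close> on a neighbourhood, and
  this map preserves classes. Openness of the projection and the formula for coordinate changes both
  rest on it.\<close>

lemma proj_eq_locally:
  assumes p: "p \<in> topspace W" and p': "p' \<in> topspace W" and eq: "\<pi> p = \<pi> p'"
  obtains S f d B where "(S, f, d) \<in> gluing_maps N \<psi>" "openin W B" "p \<in> B" "fst ` B \<subseteq> S"
    "gluing_shift f d p = p'" "continuous_map (subtopology W B) W (gluing_shift f d)"
    "\<And>z. z \<in> B \<Longrightarrow> \<pi> (gluing_shift f d z) = \<pi> z"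
proof -
  have cont: "continuous_map (subtopology W B) W (gluing_shift f d)"
    if "(S, f, d) \<in> gluing_maps N \<psi>" "fst ` B \<subseteq> S" "\<And>z. z \<in> B \<Longrightarrow> gluing_shift f d z \<in> topspace W" for S f d B
  proof -
    have "continuous_map (subtopology W B) (subtopology N S) fst"
      using that(2) by (auto simp: continuous_map_in_subtopology intro: continuous_map_from_subtopology continuous_map_W)
    moreover have "continuous_map (subtopology N S) N f"
      using gluing_map(2)[OF that(1)] by (simp add: manifold_smooth_def)
    ultimately have "continuous_map (subtopology W B) N (f \<circ> fst)"
      by (rule continuous_map_compose)
    then have "continuous_map (subtopology W B) N (\<lambda>p. f (fst p))"
      by (simp add: o_def)
    then have "continuous_map (subtopology W B) (prod_topology N (prod_topology euclideanreal euclideanreal))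
        (\<lambda>p. (f (fst p), fst (snd p), snd (snd p) + d))"
      by (intro continuous_map_pairedI continuous_map_add continuous_map_const[THEN iffD2]
          continuous_map_from_subtopology[OF continuous_map_W(2)] continuous_map_from_subtopology[OF continuous_map_W(3)]) auto
    moreover have "(\<lambda>p. (f (fst p), fst (snd p), snd (snd p) + d)) = gluing_shift f d"
      by (auto simp: fun_eq_iff)
    ultimately have "continuous_map (subtopology W B) (prod_topology N (prod_topology euclideanreal euclideanreal)) (gluing_shift f d)"
      by simp
    then show ?thesis
      using that(3) unfolding topspace_W by (auto simp: W_topology_def continuous_map_in_subtopology)
  qed
  consider "p = p'" | "W_glue \<psi> p p'" | "W_glue \<psi> p' p"
    using eq proj_eq_iff[OF p p'] by blast
  then show thesis
  proof cases
    case 1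
    have m: "(topspace N, id, 0) \<in> gluing_maps N \<psi>" by (simp add: gluing_maps_def)
    have i: "gluing_shift id 0 z = z" for z :: "'a \<times> real \<times> real" by (cases z) simp
    have sub: "fst ` topspace W \<subseteq> topspace N" using topspace_W_bounds by auto
    show ?thesis
      by (rule that[of "topspace N" id 0 "topspace W", OF m]) (use 1 p i sub cont[OF m sub] in auto)
  next
    case 2
    then obtain i x y s t where i: "i \<ge> 1" "p = (x, s, t)" "p' = (y, s, t - 2)" "\<psi> i x = Some y"
      "real i < s" "s < real i + 1" "2 < t" "t < 3" by (rule glue_D)
    let ?B = "dom (\<psi> i) \<times> {real i<..<real i + 1} \<times> {2<..<3}"
    have m: "(dom (\<psi> i), the \<circ> \<psi> i, -2) \<in> gluing_maps N \<psi>" using i by (auto simp: gluing_maps_def)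
    have glue: "W_glue \<psi> z (gluing_shift (the \<circ> \<psi> i) (-2) z)" if "z \<in> ?B" for z
      using that i(1) by (auto simp: W_glue_def)
    have "?B \<subseteq> topspace W" using glue glue_in_W by blast
    then have "openin W ?B" using gluing_map(1)[OF m] by (intro openin_W_box) auto
    moreover have "p \<in> ?B" "gluing_shift (the \<circ> \<psi> i) (-2) p = p'" using i by auto
    moreover have "continuous_map (subtopology W ?B) W (gluing_shift (the \<circ> \<psi> i) (-2))"
      by (rule cont[OF m _ glue_in_W(2)[OF glue]]) auto
    moreover have "\<pi> (gluing_shift (the \<circ> \<psi> i) (-2) z) = \<pi> z" if "z \<in> ?B" for z
      using glue[OF that] glue_in_W by (subst proj_eq_iff) blast+
    ultimately show ?thesis using that[OF m, of ?B] by auto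
  next
    case 3
    then obtain i x y s t where i: "i \<ge> 1" "p' = (x, s, t)" "p = (y, s, t - 2)" "\<psi> i x = Some y"
      "real i < s" "s < real i + 1" "2 < t" "t < 3" by (rule glue_D)
    \<comment> \<open>The lower end of the handle, with the same gluing read backwards: hence the
      inverse transition and the shift by 2 upwards.\<close>
    let ?B = "ran (\<psi> i) \<times> {real i<..<real i + 1} \<times> {0<..<1}"
    let ?f = "the \<circ> partial_inverse (\<psi> i)"
    have m: "(ran (\<psi> i), ?f, 2) \<in> gluing_maps N \<psi>" using i by (auto simp: gluing_maps_def)
    have f: "?f y = x" if "\<psi> i x = Some y" for x y using partial_inverse_iff[OF i(1), of y x] that by simp
    have glue: "W_glue \<psi> (gluing_shift ?f 2 z) z" if zB: "z \<in> ?B" for z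
    proof -
      obtain y s t where z: "z = (y, s, t)" by (cases z)
      obtain x where "\<psi> i x = Some y" using zB z by (auto simp: ran_def)
      then show ?thesis using zB i(1) z f[of x y] by (auto simp: W_glue_def)
    qed
    have "?B \<subseteq> topspace W" using glue glue_in_W by blast
    then have "openin W ?B" using gluing_map(1)[OF m] by (intro openin_W_box) auto
    moreover have "p \<in> ?B" "gluing_shift ?f 2 p = p'" using i f by (auto simp: ranI)
    moreover have "continuous_map (subtopology W ?B) W (gluing_shift ?f 2)"
      by (rule cont[OF m _ glue_in_W(1)[OF glue]]) auto
    moreover have "\<pi> (gluing_shift ?f 2 z) = \<pi> z" if "z \<in> ?B" for z
      using glue[OF that] glue_in_W by (subst proj_eq_iff) blast+
    ultimately show ?thesis using that[OF m, of ?B] by auto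
  qed
qed

lemma continuous_map_proj: "continuous_map W M \<pi>"
  using quotient_map_proj by (rule quotient_imp_continuous_map)

text \<open>The saturation of an open set is open: near each of its points a gluing map is
  continuous and moves that point into the set, so the preimage of the set under this map is an open
  part of the saturation.\<close>

lemma open_map_proj: "open_map W M \<pi>"
  unfolding open_map_def
proof (intro allI impI)
  fix Q assume Q: "openin W Q"
  have "openin W {z \<in> topspace W. \<pi> z \<in> \<pi> ` Q}"
  proof (subst openin_subopen, intro ballI)
    fix z assume "z \<in> {z \<in> topspace W. \<pi> z \<in> \<pi> ` Q}"
    then obtain p where p: "z \<in> topspace W" "p \<in> Q" "\<pi> z = \<pi> p" by auto
    then have "p \<in> topspace W" using Q openin_subset by blast
    from proj_eq_locally[OF p(1) this p(3)] obtain S f d B where B: "openin W B" "z \<in> B"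
      "gluing_shift f d z = p" "continuous_map (subtopology W B) W (gluing_shift f d)"
      "\<And>z. z \<in> B \<Longrightarrow> \<pi> (gluing_shift f d z) = \<pi> z"
      by metis
    let ?T = "{w \<in> topspace (subtopology W B). gluing_shift f d w \<in> Q}"
    have "openin W ?T"
      using openin_continuous_map_preimage[OF B(4) Q] B(1) openin_trans_full by blast
    moreover have "?T \<subseteq> {z \<in> topspace W. \<pi> z \<in> \<pi> ` Q}"
      using B(5) by (auto simp: image_iff) metis
    ultimately show "\<exists>T. openin W T \<and> z \<in> T \<and> T \<subseteq> {z \<in> topspace W. \<pi> z \<in> \<pi> ` Q}"
      using B p by (intro exI[of _ ?T]) auto
  qed
  then show "openin M (\<pi> ` Q)"
    using openin_subset[OF Q] unfolding M_topology_def by (auto simp: openin_quotient_topology)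
qed

end

section \<open>Charts of the quotient\<close>

text \<open>The coordinate function of \<open>W_charts\<close>, without its domain.\<close>

definition product_coords :: "nat \<Rightarrow> ('a \<Rightarrow> nat \<Rightarrow> real) \<Rightarrow> 'a \<times> real \<times> real \<Rightarrow> nat \<Rightarrow> real" where
  "product_coords n \<phi> = (\<lambda>(x, s, t). (\<phi> x)(n := s, n + 1 := t))"

lemma product_coords_simp [simp]: "product_coords n \<phi> (x, s, t) = (\<phi> x)(n := s, n + 1 := t)"
  by (simp add: product_coords_def)

context gluing
begin

section \<open>Separation and countability of the quotient\<close>

lemma Hausdorff_W: "Hausdorff_space W"
  using manifold_N unfolding W_topology_def smooth_manifold_def
  by (intro Hausdorff_space_subtopology) (simp add: Hausdorff_space_prod_topology)

lemma second_countable_W: "second_countable W"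
  using manifold_N unfolding W_topology_def smooth_manifold_def
  by (intro second_countable_subtopology second_countable_prod_topology second_countable_euclidean) auto

lemma proj_neq:
  assumes "z \<in> topspace W" "z' \<in> topspace W" "z \<noteq> z'" "\<bar>snd (snd z) - snd (snd z')\<bar> < 2"
  shows "\<pi> z \<noteq> \<pi> z'"
  using assms by (auto simp: proj_eq_iff elim!: glue_D)

text \<open>Disjoint neighbourhoods in \<open>W\<close> are not enough, since their images may meet
  through the gluing. Cutting them down to thin strips keeps all heights less than 2 apart, and
  distinct points that close are never glued.\<close>

lemma separate_in_M:
  assumes p: "p \<in> topspace W" and p': "p' \<in> topspace W" and neq: "p \<noteq> p'"
    and near: "\<bar>snd (snd p) - snd (snd p')\<bar> < 2"
  shows "\<exists>G H. openin M G \<and> openin M H \<and> \<pi> p \<in> G \<and> \<pi> p' \<in> H \<and> disjnt G H"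
proof -
  obtain G H where GH: "openin W G" "openin W H" "p \<in> G" "p' \<in> H" "disjnt G H"
    using Hausdorff_W p p' neq unfolding Hausdorff_space_def by blast
  \<comment> \<open>With half-widths \<open>e\<close> the difference of heights grows by less than
    \<open>2 * e\<close>, which is exactly the margin left below 2.\<close>
  define e where "e = (2 - \<bar>snd (snd p) - snd (snd p')\<bar>) / 2"
  have e: "e > 0" using near by (simp add: e_def)
  define strip where "strip q = {z \<in> topspace W. snd (snd z) \<in> {snd (snd q) - e<..<snd (snd q) + e}}" for q :: "'a \<times> real \<times> real"
  have strip: "openin W (strip q)" for q
    unfolding strip_def by (rule openin_continuous_map_preimage[OF continuous_map_W(3)]) simp
  have "disjnt (\<pi> ` (G \<inter> strip p)) (\<pi> ` (H \<inter> strip p'))"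
  proof -
    have "\<pi> z \<noteq> \<pi> z'" if "z \<in> G \<inter> strip p" "z' \<in> H \<inter> strip p'" for z z'
    proof (rule proj_neq)
      show "z \<noteq> z'" using that GH(5) by (auto simp: disjnt_def)
      have "\<bar>snd (snd z) - snd (snd z')\<bar> < \<bar>snd (snd p) - snd (snd p')\<bar> + 2 * e"
        using that unfolding strip_def by auto
      moreover have "2 * e = 2 - \<bar>snd (snd p) - snd (snd p')\<bar>" by (simp add: e_def)
      ultimately show "\<bar>snd (snd z) - snd (snd z')\<bar> < 2" by linarith
    qed (use that in \<open>auto simp: strip_def\<close>)
    then show ?thesis unfolding disjnt_def by blast
  qed
  moreover have "openin M (\<pi> ` (G \<inter> strip p))" "openin M (\<pi> ` (H \<inter> strip p'))"
    using open_map_proj openin_Int[OF GH(1) strip[of p]] openin_Int[OF GH(2) strip[of p']]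
    unfolding open_map_def by blast+
  moreover have "p \<in> G \<inter> strip p" "p' \<in> H \<inter> strip p'"
    using GH p p' e by (auto simp: strip_def)
  ultimately show ?thesis by blast
qed

lemma topspace_M: "topspace M = \<pi> ` topspace W"
  using quotient_map_proj by (simp add: quotient_imp_surjective_map)

text \<open>A point above height 2 lies in the handle of some generator, which moves it down by 2.
  Height 2 itself is not glued to anything, so the bound cannot be made strict.\<close>

lemma low_representative:
  assumes "q \<in> topspace M"
  obtains x s t where "(x, s, t) \<in> topspace W" "\<pi> (x, s, t) = q" "t \<le> 2"
proof -
  obtain x s t where p: "(x, s, t) \<in> topspace W" "\<pi> (x, s, t) = q"
    using assms by (auto simp: topspace_M)
  show thesis
  proof (cases "t \<le> 2")
    case False
    then obtain i y where i: "i \<ge> 1" "\<psi> i x = Some y" "real i < s" "s < real i + 1" "t < 3"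
      using p(1) by (auto simp: mem_W)
    then have "W_glue \<psi> (x, s, t) (y, s, t - 2)"
      using False by (auto simp: W_glue_def)
    then have "(y, s, t - 2) \<in> topspace W" "\<pi> (y, s, t - 2) = \<pi> (x, s, t)"
      using glue_in_W(2) p(1) by (auto simp: proj_eq_iff)
    then show ?thesis using that[of y s "t - 2"] i p by auto
  qed (use that p in auto)
qed

lemma Hausdorff_M: "Hausdorff_space M"
  unfolding Hausdorff_space_def
proof (intro allI impI)
  fix q q' assume *: "q \<in> topspace M \<and> q' \<in> topspace M \<and> q \<noteq> q'"
  obtain x s t where p: "(x, s, t) \<in> topspace W" "\<pi> (x, s, t) = q" "t \<le> 2"
    using * by (meson low_representative)
  obtain x' s' t' where p': "(x', s', t') \<in> topspace W" "\<pi> (x', s', t') = q'" "t' \<le> 2"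
    using * by (meson low_representative)
  \<comment> \<open>The strict lower bound is decisive: two numbers in \<open>(0, 2]\<close> differ
    by less than 2.\<close>
  have "0 < t" "0 < t'" using topspace_W_bounds p(1) p'(1) by blast+
  then have "\<bar>t - t'\<bar> < 2" using p(3) p'(3) by linarith
  then show "\<exists>G H. openin M G \<and> openin M H \<and> q \<in> G \<and> q' \<in> H \<and> disjnt G H"
    using separate_in_M[OF p(1) p'(1)] p(2) p'(2) * by auto
qed

lemma second_countable_M: "second_countable M"
  using second_countable_open_map_image[OF continuous_map_proj open_map_proj _ second_countable_W] topspace_M by simp

section \<open>Charts of the quotient and their coordinate changes\<close>

lemma chart_D:
  assumes "(U, \<phi>) \<in> A"
  shows "openin N U" "openin (Euclidean_space n) (\<phi> ` U)" "inj_on \<phi> U" "\<phi> ` U \<subseteq> cart n"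
    "homeomorphic_map (subtopology N U) (subtopology (Euclidean_space n) (\<phi> ` U)) \<phi>"
    "continuous_map (subtopology N U) (Euclidean_space n) \<phi>"
    "continuous_map (subtopology (Euclidean_space n) (\<phi> ` U)) N (inv_into U \<phi>)"
proof -
  have c: "is_chart n N (U, \<phi>)"
    using manifold_N assms by (auto simp: smooth_manifold_def)
  then show 1: "openin N U" and 2: "openin (Euclidean_space n) (\<phi> ` U)"
    and h: "homeomorphic_map (subtopology N U) (subtopology (Euclidean_space n) (\<phi> ` U)) \<phi>"
    by (auto simp: is_chart_def chart_image_def)
  have U: "topspace (subtopology N U) = U" "topspace (subtopology (Euclidean_space n) (\<phi> ` U)) = \<phi> ` U"
    using openin_subset[OF 1] openin_subset[OF 2] by auto
  then show i: "inj_on \<phi> U"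
    using homeomorphic_imp_injective_map[OF h] by simp
  show "\<phi> ` U \<subseteq> cart n" using 2 openin_subset by blast
  show "continuous_map (subtopology N U) (Euclidean_space n) \<phi>"
    using homeomorphic_imp_continuous_map[OF h] by (simp add: continuous_map_in_subtopology)
  have "continuous_map (subtopology (Euclidean_space n) (\<phi> ` U)) (subtopology N U) (inv_into U \<phi>)"
    by (rule open_eq_continuous_inverse_map[THEN iffD1, OF _ _ homeomorphic_imp_open_map[OF h]])
      (use i in \<open>simp_all only: U, auto\<close>)
  then show "continuous_map (subtopology (Euclidean_space n) (\<phi> ` U)) N (inv_into U \<phi>)"
    by (simp add: continuous_map_in_subtopology)
qed

text \<open>The explicit inverse \<open>\<Psi>\<close> is continuous on the open set
  \<open>?Z\<close> of all points above the image of the chart of \<open>N\<close>. Its values may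
  lie outside \<open>W\<close>, so it is treated as a map into the full product.\<close>

lemma product_chart:
  assumes c: "(U, \<phi>) \<in> A" and Q: "openin W Q" "Q \<subseteq> U \<times> UNIV \<times> UNIV"
  shows "openin (Euclidean_space (n + 2)) (product_coords n \<phi> ` Q)"
    and "inj_on (product_coords n \<phi>) Q"
    and "homeomorphic_map (subtopology W Q) (subtopology (Euclidean_space (n + 2)) (product_coords n \<phi> ` Q))
      (product_coords n \<phi>)"
proof -
  let ?E = "Euclidean_space (n + 2)"
  define \<Phi> where "\<Phi> = product_coords n \<phi>"
  define \<Psi> where "\<Psi> z = (inv_into U \<phi> (cart_proj n z), z n, z (n + 1))" for z
  have cart: "\<phi> x \<in> cart n" if "x \<in> U" for x using chart_D(4)[OF c] that by blast
  have \<Phi>_cart: "\<Phi> p \<in> cart (n + 2)" if "p \<in> Q" for p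
    using that Q(2) cart cart_upd2 by (cases p) (auto simp: \<Phi>_def)
  have \<Psi>\<Phi>: "\<Psi> (\<Phi> p) = p" if "p \<in> Q" for p
  proof -
    obtain x s t where p: "p = (x, s, t)" by (cases p)
    then have "x \<in> U" using that Q(2) by blast
    then show ?thesis
      using p cart_proj_upd2[OF cart] chart_D(3)[OF c] by (simp add: \<Psi>_def \<Phi>_def)
  qed
  let ?Z = "{z \<in> cart (n + 2). cart_proj n z \<in> \<phi> ` U}"
  have \<Phi>\<Psi>: "\<Phi> (\<Psi> z) = z" if "z \<in> ?Z" for z
    using that cart_proj_upd2_id by (auto simp: \<Psi>_def \<Phi>_def f_inv_into_f)
  have Z: "openin ?E ?Z"
    by (rule openin_continuous_map_preimage[OF continuous_map_cart_proj chart_D(2)[OF c]])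
  have \<Phi>Z: "\<Phi> p \<in> ?Z" if "p \<in> Q" for p
  proof -
    obtain x s t where p: "p = (x, s, t)" by (cases p)
    then have "x \<in> U" using that Q(2) by blast
    then show ?thesis using p cart_proj_upd2[OF cart] \<Phi>_cart[OF that] by (simp add: \<Phi>_def)
  qed
  have "continuous_map (subtopology ?E ?Z) (subtopology (Euclidean_space n) (\<phi> ` U)) (cart_proj n)"
    by (auto simp: continuous_map_in_subtopology intro: continuous_map_from_subtopology continuous_map_cart_proj)
  from continuous_map_compose[OF this chart_D(7)[OF c]]
  have "continuous_map (subtopology ?E ?Z) N (\<lambda>z. inv_into U \<phi> (cart_proj n z))"
    by (simp add: o_def)
  then have \<Psi>_cont: "continuous_map (subtopology ?E ?Z) (prod_topology N (prod_topology euclideanreal euclideanreal)) \<Psi>"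
    unfolding \<Psi>_def
    by (intro continuous_map_pairedI continuous_map_from_subtopology[OF continuous_map_cart_component])
  \<comment> \<open>Images under \<open>\<Phi>\<close> become preimages under the continuous
    \<open>\<Psi>\<close>, which gives openness directly.\<close>
  have image: "\<Phi> ` S = {z \<in> topspace (subtopology ?E ?Z). \<Psi> z \<in> S}" if "S \<subseteq> Q" for S
    using that \<Psi>\<Phi> \<Phi>\<Psi> \<Phi>Z \<Phi>_cart by (auto simp: image_iff subset_iff) metis
  have open_image: "openin ?E (\<Phi> ` S)" if "openin W S" "S \<subseteq> Q" for S
    unfolding image[OF that(2)]
    using openin_continuous_map_preimage[OF \<Psi>_cont] Z that(1) openin_trans_full unfolding openin_W by blast
  then show o: "openin ?E (product_coords n \<phi> ` Q)"
    using Q(1) by (simp add: \<Phi>_def)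
  show i: "inj_on (product_coords n \<phi>) Q"
    using \<Psi>\<Phi> unfolding \<Phi>_def by (metis inj_on_inverseI)
  have top: "topspace W \<inter> Q = Q" using openin_subset[OF Q(1)] by auto
  have "continuous_map (subtopology W Q) ?E \<Phi>"
  proof (rule continuous_map_into_cart)
    have "continuous_map (subtopology W Q) (subtopology N U) fst"
      using Q(2) by (auto simp: continuous_map_in_subtopology intro: continuous_map_from_subtopology continuous_map_W)
    from continuous_map_compose[OF continuous_map_compose[OF this chart_D(6)[OF c]] continuous_map_cart_component]
    have 1: "continuous_map (subtopology W Q) euclideanreal (\<lambda>p. \<phi> (fst p) i)" for i
      by (simp add: o_def)
    fix i assume "i < n + 2"
    have "(\<lambda>p. \<Phi> p i) = (if i = n + 1 then (\<lambda>p. snd (snd p)) else if i = n then (\<lambda>p. fst (snd p)) else (\<lambda>p. \<phi> (fst p) i))"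
      by (auto simp: \<Phi>_def product_coords_def)
    then show "continuous_map (subtopology W Q) euclideanreal (\<lambda>p. \<Phi> p i)"
      using 1 continuous_map_from_subtopology[OF continuous_map_W(2)] continuous_map_from_subtopology[OF continuous_map_W(3)]
      by simp
  qed (use \<Phi>_cart top in simp)
  moreover have "open_map (subtopology W Q) (subtopology ?E (\<Phi> ` Q)) \<Phi>"
    unfolding open_map_def
  proof (intro allI impI)
    fix S assume "openin (subtopology W Q) S"
    then have "openin W S" "S \<subseteq> Q" using Q(1) by (auto simp: openin_open_subtopology)
    then show "openin (subtopology ?E (\<Phi> ` Q)) (\<Phi> ` S)"
      using open_image o by (auto simp: openin_open_subtopology \<Phi>_def)
  qed
  moreover have "topspace (subtopology ?E (\<Phi> ` Q)) = \<Phi> ` Q"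
    using openin_subset[OF o] by (auto simp: \<Phi>_def)
  ultimately show "homeomorphic_map (subtopology W Q) (subtopology ?E (product_coords n \<phi> ` Q)) (product_coords n \<phi>)"
    using i unfolding \<Phi>_def[symmetric]
    by (intro bijective_open_imp_homeomorphic_map) (auto simp: top continuous_map_in_subtopology)
qed

lemma M_charts_iff: "c \<in> M_charts n N A \<psi> \<longleftrightarrow> (\<exists>U \<phi> Q. (U, \<phi>) \<in> A \<and> openin W Q \<and> Q \<subseteq> U \<times> UNIV \<times> UNIV \<and>
    inj_on \<pi> Q \<and> c = (\<pi> ` Q, product_coords n \<phi> \<circ> inv_into Q \<pi>))" (is "_ \<longleftrightarrow> ?R")
proof
  assume "c \<in> M_charts n N A \<psi>"
  then obtain V \<theta> Q where Q: "(V, \<theta>) \<in> W_charts n N A \<psi>" "openin W Q" "Q \<subseteq> V" "inj_on \<pi> Q"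
      "c = (\<pi> ` Q, \<theta> \<circ> inv_into Q \<pi>)"
    unfolding M_charts_def quotient_charts_def by auto
  from Q(1) obtain U \<phi> where "(U, \<phi>) \<in> A" "V = (U \<times> UNIV \<times> UNIV) \<inter> W_set (topspace N) \<psi>" "\<theta> = product_coords n \<phi>"
    unfolding W_charts_def product_coords_def by auto
  with Q show ?R by (intro exI[of _ U] exI[of _ \<phi>] exI[of _ Q]) auto
next
  assume ?R
  then obtain U \<phi> Q where Q: "(U, \<phi>) \<in> A" "openin W Q" "Q \<subseteq> U \<times> UNIV \<times> UNIV" "inj_on \<pi> Q"
      "c = (\<pi> ` Q, product_coords n \<phi> \<circ> inv_into Q \<pi>)"
    by auto
  have "((U \<times> UNIV \<times> UNIV) \<inter> W_set (topspace N) \<psi>, product_coords n \<phi>) \<in> W_charts n N A \<psi>"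
    unfolding W_charts_def product_coords_def by (rule image_eqI[OF _ Q(1)]) simp
  moreover have "Q \<subseteq> (U \<times> UNIV \<times> UNIV) \<inter> W_set (topspace N) \<psi>"
    using Q(3) openin_subset[OF Q(2)] unfolding topspace_W by simp
  ultimately show "c \<in> M_charts n N A \<psi>"
    unfolding M_charts_def quotient_charts_def using Q(2,4,5) by (intro CollectI exI conjI)
qed

text \<open>A continuous open map is a homeomorphism onto its image on any open set where it is
  injective.\<close>

lemma proj_inj_homeomorphic:
  assumes "openin W Q" "inj_on \<pi> Q"
  shows "homeomorphic_map (subtopology M (\<pi> ` Q)) (subtopology W Q) (inv_into Q \<pi>)"
proof -
  have o: "openin M (\<pi> ` Q)" using open_map_proj assms(1) by (simp add: open_map_def)
  have top: "topspace W \<inter> Q = Q" "topspace M \<inter> \<pi> ` Q = \<pi> ` Q"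
    using openin_subset[OF assms(1)] openin_subset[OF o] by auto
  have "open_map (subtopology W Q) (subtopology M (\<pi> ` Q)) \<pi>"
    unfolding open_map_def
  proof (intro allI impI)
    fix S assume "openin (subtopology W Q) S"
    then have "openin W S" "S \<subseteq> Q" using assms(1) by (auto simp: openin_open_subtopology)
    then show "openin (subtopology M (\<pi> ` Q)) (\<pi> ` S)"
      using open_map_proj o by (auto simp: openin_open_subtopology open_map_def)
  qed
  then have "continuous_map (subtopology M (\<pi> ` Q)) (subtopology W Q) (inv_into Q \<pi>)"
    by (rule open_eq_continuous_inverse_map[THEN iffD1, rotated 2])
      (use assms(2) in \<open>auto simp: top f_inv_into_f inv_into_into\<close>)
  moreover have "continuous_map (subtopology W Q) (subtopology M (\<pi> ` Q)) \<pi>"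
    by (auto simp: continuous_map_in_subtopology intro: continuous_map_from_subtopology continuous_map_proj)
  ultimately have "homeomorphic_maps (subtopology M (\<pi> ` Q)) (subtopology W Q) (inv_into Q \<pi>) \<pi>"
    using assms(2) by (auto simp: homeomorphic_maps_def top f_inv_into_f)
  then show ?thesis by (rule homeomorphic_maps_imp_map)
qed

lemma quotient_chart:
  assumes "(U, \<phi>) \<in> A" "openin W Q" "Q \<subseteq> U \<times> UNIV \<times> UNIV" "inj_on \<pi> Q"
    and c: "c = (\<pi> ` Q, product_coords n \<phi> \<circ> inv_into Q \<pi>)"
  shows "chart_image c = product_coords n \<phi> ` Q" "is_chart (n + 2) M c" "inj_on (snd c) (fst c)"
proof -
  have im: "inv_into Q \<pi> ` \<pi> ` Q = Q" using assms(4) by simp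
  show ci: "chart_image c = product_coords n \<phi> ` Q"
    unfolding chart_image_def c fst_conv snd_conv image_comp[symmetric] im ..
  show "is_chart (n + 2) M c"
    unfolding is_chart_def ci
  proof (intro conjI)
    show "openin M (fst c)" using open_map_proj assms(2) by (simp add: c open_map_def)
    show "openin (Euclidean_space (n + 2)) (product_coords n \<phi> ` Q)"
      by (rule product_chart(1)[OF assms(1-3)])
    show "homeomorphic_map (subtopology M (fst c)) (subtopology (Euclidean_space (n + 2)) (product_coords n \<phi> ` Q)) (snd c)"
      unfolding c fst_conv snd_conv
      by (rule homeomorphic_map_compose[OF proj_inj_homeomorphic[OF assms(2,4)] product_chart(3)[OF assms(1-3)]])
  qed
  show "inj_on (snd c) (fst c)"
    unfolding c fst_conv snd_conv
    by (rule comp_inj_on) (simp_all only: im product_chart(2)[OF assms(1-3)] inj_on_inv_into[OF subset_refl])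
qed

lemma M_charts_cover: "(\<Union>c\<in>M_charts n N A \<psi>. fst c) = topspace M"
proof
  show "(\<Union>c\<in>M_charts n N A \<psi>. fst c) \<subseteq> topspace M"
  proof
    fix q assume "q \<in> (\<Union>c\<in>M_charts n N A \<psi>. fst c)"
    then obtain Q where "openin W Q" "q \<in> \<pi> ` Q" by (auto simp: M_charts_iff)
    then show "q \<in> topspace M" unfolding topspace_M using openin_subset by blast
  qed
  show "topspace M \<subseteq> (\<Union>c\<in>M_charts n N A \<psi>. fst c)"
  proof
    fix q assume "q \<in> topspace M"
    then obtain x s t where p: "(x, s, t) \<in> topspace W" "q = \<pi> (x, s, t)"
      by (auto simp: topspace_M)
    have "x \<in> (\<Union>c\<in>A. fst c)"
      using manifold_N topspace_W_bounds[OF p(1)] by (auto simp: smooth_manifold_def)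
    then obtain U \<phi> where c: "(U, \<phi>) \<in> A" "x \<in> U" by force
    \<comment> \<open>A strip of height 2 around the point: any two heights in it differ by less
      than 2, so no two distinct points of it are glued.\<close>
    define Q where "Q = {z \<in> topspace W. fst z \<in> U} \<inter> {z \<in> topspace W. snd (snd z) \<in> {t - 1<..<t + 1}}"
    have "openin W Q"
      unfolding Q_def
      by (intro openin_Int openin_continuous_map_preimage[OF continuous_map_W(1) chart_D(1)[OF c(1)]]
          openin_continuous_map_preimage[OF continuous_map_W(3)]) simp
    moreover have "Q \<subseteq> U \<times> UNIV \<times> UNIV" by (auto simp: Q_def)
    moreover have "inj_on \<pi> Q"
    proof (rule inj_onI, rule ccontr)
      fix z z' assume "z \<in> Q" "z' \<in> Q" "\<pi> z = \<pi> z'" "z \<noteq> z'"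
      moreover from this have "\<bar>snd (snd z) - snd (snd z')\<bar> < 2"
        unfolding Q_def abs_less_iff by auto
      ultimately show False using proj_neq[of z z'] by (auto simp: Q_def)
    qed
    moreover have "q \<in> \<pi> ` Q" using p c by (auto simp: Q_def)
    ultimately have "(\<pi> ` Q, product_coords n \<phi> \<circ> inv_into Q \<pi>) \<in> M_charts n N A \<psi>" "q \<in> \<pi> ` Q"
      using c(1) unfolding M_charts_iff by blast+
    then show "q \<in> (\<Union>c\<in>M_charts n N A \<psi>. fst c)" by force
  qed
qed

text \<open>A class in both chart domains has one representative in \<open>Q\<close> and one in
  \<open>Q'\<close>, and the gluing map between them persists nearby. The condition on
  \<open>cart_proj n z\<close> records that the transverse part is evaluated where the gluing map is
  defined and lands in the second chart, as its smoothness and invariance will require.\<close>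

lemma coord_change_locally:
  assumes c: "(U, \<phi>) \<in> A" "openin W Q" "Q \<subseteq> U \<times> UNIV \<times> UNIV" "inj_on \<pi> Q"
      "c = (\<pi> ` Q, product_coords n \<phi> \<circ> inv_into Q \<pi>)"
    and c': "(U', \<phi>') \<in> A" "openin W Q'" "Q' \<subseteq> U' \<times> UNIV \<times> UNIV" "inj_on \<pi> Q'"
      "c' = (\<pi> ` Q', product_coords n \<phi>' \<circ> inv_into Q' \<pi>)"
    and y: "y \<in> snd c ` (fst c \<inter> fst c')"
  obtains S f d B where "(S, f, d) \<in> gluing_maps N \<psi>" "openin (Euclidean_space (n + 2)) B" "y \<in> B"
    "B \<subseteq> snd c ` (fst c \<inter> fst c')" "\<forall>z\<in>B. cart_proj n z \<in> \<phi> ` {x \<in> U \<inter> S. f x \<in> U'}"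
    "\<forall>z\<in>B. coord_change c c' z =
      ((\<phi>' \<circ> f \<circ> inv_into U \<phi>) (cart_proj n z))(n := z n, n + 1 := z (n + 1) + d)"
proof -
  obtain q where q: "q \<in> fst c" "q \<in> fst c'" "y = snd c q" using y by blast
  then obtain p p' where p: "p \<in> Q" "\<pi> p = q" "p' \<in> Q'" "\<pi> p' = q" using c(5) c'(5) by auto
  then have "p \<in> topspace W" "p' \<in> topspace W" "\<pi> p = \<pi> p'"
    using openin_subset[OF c(2)] openin_subset[OF c'(2)] by auto
  then obtain S f d G where G: "(S, f, d) \<in> gluing_maps N \<psi>" "openin W G" "p \<in> G" "fst ` G \<subseteq> S"
    "gluing_shift f d p = p'" "continuous_map (subtopology W G) W (gluing_shift f d)"
    "\<And>z. z \<in> G \<Longrightarrow> \<pi> (gluing_shift f d z) = \<pi> z"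
    by (rule proj_eq_locally) blast
  \<comment> \<open>The points of \<open>Q\<close> near \<open>p\<close> that the gluing map sends
    into \<open>Q'\<close>; their classes lie in both chart domains.\<close>
  define T where "T = {w \<in> topspace (subtopology W G). gluing_shift f d w \<in> Q'} \<inter> Q"
  have "openin W T"
    unfolding T_def using openin_continuous_map_preimage[OF G(6) c'(2)] G(2) c(2) openin_trans_full by blast
  have TQ: "T \<subseteq> Q" "T \<subseteq> U \<times> UNIV \<times> UNIV" using c(3) by (auto simp: T_def)
  let ?B = "product_coords n \<phi> ` T"
  have snd_c: "snd c (\<pi> w) = product_coords n \<phi> w" if "w \<in> T" for w
    using that TQ c(4,5) by auto
  have local: "product_coords n \<phi> w \<in> snd c ` (fst c \<inter> fst c') \<and>
      cart_proj n (product_coords n \<phi> w) \<in> \<phi> ` {x \<in> U \<inter> S. f x \<in> U'} \<and>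
      coord_change c c' (product_coords n \<phi> w) =
        ((\<phi>' \<circ> f \<circ> inv_into U \<phi>) (cart_proj n (product_coords n \<phi> w)))
          (n := product_coords n \<phi> w n, n + 1 := product_coords n \<phi> w (n + 1) + d)" if w: "w \<in> T" for w
  proof -
    obtain x s t where xst: "w = (x, s, t)" by (cases w)
    have shift: "gluing_shift f d w \<in> Q'" and wG: "w \<in> G" and wQ: "w \<in> Q" using w by (auto simp: T_def)
    have x: "x \<in> U" "x \<in> S" "f x \<in> U'" using shift wG wQ G(4) c(3) c'(3) xst by auto
    have proj: "cart_proj n (product_coords n \<phi> w) = \<phi> x"
      using chart_D(4)[OF c(1)] x(1) cart_proj_upd2[of "\<phi> x" n s t] by (auto simp: xst)
    \<comment> \<open>Hence the local inverse of the projection on \<open>Q\<close> returns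
      \<open>w\<close>, and the one on \<open>Q'\<close> returns its shift.\<close>
    have \<pi>w: "\<pi> w = \<pi> (gluing_shift f d w)" using G(7)[OF wG] by simp
    have mem: "\<pi> w \<in> fst c" "\<pi> w \<in> fst c'"
      using wQ c(5) imageI[OF shift, of \<pi>] c'(5) unfolding \<pi>w[symmetric] by simp_all
    have "inv_into (fst c) (snd c) (product_coords n \<phi> w) = \<pi> w"
      unfolding snd_c[OF w, symmetric] by (rule inv_into_f_f[OF quotient_chart(3)[OF c] mem(1)])
    then have "coord_change c c' (product_coords n \<phi> w) = product_coords n \<phi>' (inv_into Q' \<pi> (\<pi> w))"
      by (simp add: coord_change_def c'(5))
    also have "inv_into Q' \<pi> (\<pi> w) = gluing_shift f d w"
      unfolding \<pi>w by (rule inv_into_f_f[OF c'(4) shift])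
    also have "product_coords n \<phi>' (gluing_shift f d w) = ((\<phi>' \<circ> f \<circ> inv_into U \<phi>) (\<phi> x))(n := s, n + 1 := t + d)"
      using x(1) chart_D(3)[OF c(1)] by (simp add: xst)
    finally have cc: "coord_change c c' (product_coords n \<phi> w) = ((\<phi>' \<circ> f \<circ> inv_into U \<phi>) (\<phi> x))(n := s, n + 1 := t + d)" .
    show ?thesis
      unfolding proj using mem snd_c[OF w] x cc by (auto simp: xst intro!: image_eqI[of _ _ "\<pi> w"])
  qed
  have "p \<in> T" using G p openin_subset[OF G(2)] by (auto simp: T_def)
  have "y \<in> ?B"
    using snd_c[OF \<open>p \<in> T\<close>] \<open>p \<in> T\<close> q(3) p(2) by auto
  then show thesis
    using that[OF G(1) product_chart(1)[OF c(1) \<open>openin W T\<close> TQ(2)]] local by blast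
qed

lemma gluing_map_smooth_in_charts:
  assumes "(S, f, d) \<in> gluing_maps N \<psi>" and c: "(U, \<phi>) \<in> A" and c': "(U', \<phi>') \<in> A"
  defines "G \<equiv> \<phi> ` {x \<in> U \<inter> S. f x \<in> U'}" and "F \<equiv> \<phi>' \<circ> f \<circ> inv_into U \<phi>"
  shows "openin (Euclidean_space n) G" "smooth_map n n G F"
proof -
  note f = gluing_map[OF assms(1)]
  have "continuous_map (subtopology N S) N f"
    using f(2) by (simp add: manifold_smooth_def)
  then have "openin (subtopology N S) {x \<in> topspace (subtopology N S). f x \<in> U'}"
    using chart_D(1)[OF c'] by (rule openin_continuous_map_preimage)
  then have "openin N {x \<in> topspace (subtopology N S). f x \<in> U'}"
    using f(1) openin_trans_full by blast
  then have "openin N (U \<inter> {x \<in> topspace (subtopology N S). f x \<in> U'})"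
    using chart_D(1)[OF c] by blast
  moreover have "U \<inter> {x \<in> topspace (subtopology N S). f x \<in> U'} = {x \<in> U \<inter> S. f x \<in> U'}"
    using openin_subset[OF f(1)] by auto
  ultimately have "openin (subtopology N U) {x \<in> U \<inter> S. f x \<in> U'}"
    using chart_D(1)[OF c] by (auto simp: openin_open_subtopology)
  then have "openin (subtopology (Euclidean_space n) (\<phi> ` U)) G"
    using homeomorphic_imp_open_map[OF chart_D(5)[OF c]] unfolding open_map_def G_def by blast
  then show "openin (Euclidean_space n) G"
    using chart_D(2)[OF c] openin_trans_full by blast
  show "smooth_map n n G F"
    using f(2) c c' unfolding manifold_smooth_def G_def F_def by fastforce
qed

section \<open>The quotient as a foliated manifold\<close>

lemma smooth_manifold_M: "smooth_manifold (n + 2) M (M_charts n N A \<psi>)"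
  unfolding smooth_manifold_def
proof (intro conjI ballI Hausdorff_M second_countable_M M_charts_cover)
  show "is_chart (n + 2) M c" if "c \<in> M_charts n N A \<psi>" for c
    using that quotient_chart(2) by (auto simp: M_charts_iff)
  fix c c' assume "c \<in> M_charts n N A \<psi>" "c' \<in> M_charts n N A \<psi>"
  then obtain U \<phi> Q U' \<phi>' Q'
    where c: "(U, \<phi>) \<in> A" "openin W Q" "Q \<subseteq> U \<times> UNIV \<times> UNIV" "inj_on \<pi> Q"
      "c = (\<pi> ` Q, product_coords n \<phi> \<circ> inv_into Q \<pi>)"
    and c': "(U', \<phi>') \<in> A" "openin W Q'" "Q' \<subseteq> U' \<times> UNIV \<times> UNIV" "inj_on \<pi> Q'"
      "c' = (\<pi> ` Q', product_coords n \<phi>' \<circ> inv_into Q' \<pi>)"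
    unfolding M_charts_iff by blast
  let ?D = "snd c ` (fst c \<inter> fst c')"
  have local: "\<exists>B g. openin (Euclidean_space (n + 2)) B \<and> y \<in> B \<and> B \<subseteq> ?D \<and>
      (\<forall>z\<in>B. coord_change c c' z = g z) \<and> smooth_map (n + 2) (n + 2) B g" if y: "y \<in> ?D" for y
  proof -
    obtain S f d B where B: "(S, f, d) \<in> gluing_maps N \<psi>" "openin (Euclidean_space (n + 2)) B" "y \<in> B"
      "B \<subseteq> ?D" "\<forall>z\<in>B. cart_proj n z \<in> \<phi> ` {x \<in> U \<inter> S. f x \<in> U'}"
      "\<forall>z\<in>B. coord_change c c' z =
        ((\<phi>' \<circ> f \<circ> inv_into U \<phi>) (cart_proj n z))(n := z n, n + 1 := z (n + 1) + d)"
      by (rule coord_change_locally[OF c c' y])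
    let ?g = "\<lambda>z. ((\<phi>' \<circ> f \<circ> inv_into U \<phi>) (cart_proj n z))(n := z n, n + 1 := z (n + 1) + d)"
    have "B \<subseteq> {z \<in> cart (n + 2). cart_proj n z \<in> \<phi> ` {x \<in> U \<inter> S. f x \<in> U'}}"
      using B(5) openin_subset[OF B(2)] by auto
    with smooth_map_suspension[OF gluing_map_smooth_in_charts(2)[OF B(1) c(1) c'(1)], of d]
    have "smooth_map (n + 2) (n + 2) B ?g"
      by (rule smooth_map_subset)
    then show ?thesis
      using B by (intro exI[of _ B] exI[of _ ?g]) simp
  qed
  show "smooth_map (n + 2) (n + 2) ?D (coord_change c c')"
    by (rule smooth_map_locally) (rule local)
qed

text \<open>In the local formula the first \<open>n\<close> coordinates of the result depend only on
  the first \<open>n\<close> coordinates of the argument, so plaques go into plaques.\<close>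

lemma foliated_manifold_M: "foliated_manifold (n + 2) n M (M_charts n N A \<psi>)"
  unfolding foliated_manifold_def
proof (intro conjI ballI smooth_manifold_M)
  fix c c' q assume c_in: "c \<in> M_charts n N A \<psi>" "c' \<in> M_charts n N A \<psi>" and q: "q \<in> fst c \<inter> fst c'"
  from c_in obtain U \<phi> Q U' \<phi>' Q'
    where c: "(U, \<phi>) \<in> A" "openin W Q" "Q \<subseteq> U \<times> UNIV \<times> UNIV" "inj_on \<pi> Q"
      "c = (\<pi> ` Q, product_coords n \<phi> \<circ> inv_into Q \<pi>)"
    and c': "(U', \<phi>') \<in> A" "openin W Q'" "Q' \<subseteq> U' \<times> UNIV \<times> UNIV" "inj_on \<pi> Q'"
      "c' = (\<pi> ` Q', product_coords n \<phi>' \<circ> inv_into Q' \<pi>)"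
    unfolding M_charts_iff by blast
  have "snd c q \<in> snd c ` (fst c \<inter> fst c')" using q by blast
  then obtain S f d B where B: "(S, f, d) \<in> gluing_maps N \<psi>"
    "openin (Euclidean_space (n + 2)) B" "snd c q \<in> B" "B \<subseteq> snd c ` (fst c \<inter> fst c')"
    "\<forall>z\<in>B. cart_proj n z \<in> \<phi> ` {x \<in> U \<inter> S. f x \<in> U'}"
    "\<forall>z\<in>B. coord_change c c' z =
      ((\<phi>' \<circ> f \<circ> inv_into U \<phi>) (cart_proj n z))(n := z n, n + 1 := z (n + 1) + d)"
    by (rule coord_change_locally[OF c c'])
  let ?G = "{x \<in> topspace (subtopology M (fst c)). snd c x \<in> B}"
  have "homeomorphic_map (subtopology M (fst c)) (subtopology (Euclidean_space (n + 2)) (chart_image c)) (snd c)"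
    using quotient_chart(2)[OF c] unfolding is_chart_def by blast
  from homeomorphic_imp_continuous_map[OF this]
  have chart: "openin M (fst c)" "continuous_map (subtopology M (fst c)) (Euclidean_space (n + 2)) (snd c)"
    using quotient_chart(2)[OF c] unfolding is_chart_def by (simp_all add: continuous_map_in_subtopology)
  have inj: "inj_on (snd c) (fst c)" by (rule quotient_chart(3)[OF c])
  have "openin M ?G"
    using openin_continuous_map_preimage[OF chart(2) B(2)] chart(1) openin_trans_full by blast
  moreover have "q \<in> ?G" using q B(3) openin_subset[OF chart(1)] by auto
  \<comment> \<open>A point of \<open>fst c\<close> whose coordinates come from the overlap lies
    itself in the overlap, by injectivity of the chart.\<close>
  moreover have "?G \<subseteq> fst c \<inter> fst c'"
  proof
    fix x assume x: "x \<in> ?G"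
    then obtain x' where "x' \<in> fst c \<inter> fst c'" "snd c x = snd c x'" using B(4) by blast
    then show "x \<in> fst c \<inter> fst c'" using x inj by (auto dest: inj_onD)
  qed
  moreover have "snd c' x k = snd c' y k"
    if "x \<in> ?G" "y \<in> ?G" and eq: "\<forall>k<n. snd c x k = snd c y k" and "k < n" for x y k
  proof -
    have *: "snd c' x k = (\<phi>' \<circ> f \<circ> inv_into U \<phi>) (cart_proj n (snd c x)) k" if "x \<in> ?G" for x
    proof -
      have "coord_change c c' (snd c x) = snd c' x"
        using that inj by (simp add: coord_change_def)
      moreover have "coord_change c c' (snd c x) k = (\<phi>' \<circ> f \<circ> inv_into U \<phi>) (cart_proj n (snd c x)) k"
        using B(6) that \<open>k < n\<close> by simp
      ultimately show ?thesis by (simp only:)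
    qed
    have "cart_proj n (snd c x) = cart_proj n (snd c y)"
      using eq by (auto simp: cart_proj_def)
    then show ?thesis using *[OF that(1)] *[OF that(2)] by simp
  qed
  ultimately show "\<exists>G. openin M G \<and> q \<in> G \<and> G \<subseteq> fst c \<inter> fst c' \<and>
      (\<forall>x\<in>G. \<forall>y\<in>G. (\<forall>k<n. snd c x k = snd c y k) \<longrightarrow> (\<forall>k<n. snd c' x k = snd c' y k))"
    by (intro exI[of _ ?G]) blast
qed simp

end

section \<open>The transverse metric\<close>

text \<open>The pullback of \<open>h\<close> along the projection to the transverse coordinates, in
  components.\<close>

definition extend_form :: "nat \<Rightarrow> ((nat \<Rightarrow> real) \<Rightarrow> nat \<Rightarrow> nat \<Rightarrow> real) \<Rightarrow> (nat \<Rightarrow> real) \<Rightarrow> nat \<Rightarrow> nat \<Rightarrow> real" where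
  "extend_form n h y a b = (if a < n \<and> b < n then h (cart_proj n y) a b else 0)"

lemma bilinear_form_extend_form:
  "bilinear_form (n + 2) (extend_form n h y) v w = bilinear_form n (h (cart_proj n y)) v w"
  by (simp add: bilinear_form_def extend_form_def)

text \<open>The extended form vanishes on the directions of s and t, so the double sum shrinks to
  the transverse components of the map, and these are constant along s and t. The premise ensures
  that truncating the suspended value returns the value of \<open>F\<close>.\<close>

lemma pullback_suspension:
  assumes "F (cart_proj n y) \<in> cart n"
  shows "pullback (n + 2) (\<lambda>z. (F (cart_proj n z))(n := z n, n + 1 := z (n + 1) + d)) (extend_form n h) y a b =
    (if a < n \<and> b < n then pullback n F h (cart_proj n y) a b else 0)"
    (is "pullback (n + 2) ?f _ _ _ _ = _")
proof -
  have proj: "cart_proj n (?f y) = F (cart_proj n y)"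
    using cart_proj_upd2[OF assms] by simp
  have "pullback (n + 2) ?f (extend_form n h) y a b =
      (\<Sum>k<n. \<Sum>l<n. pd a (\<lambda>z. ?f z k) y * pd b (\<lambda>z. ?f z l) y * h (F (cart_proj n y)) k l)"
    unfolding pullback_def extend_form_def proj by simp
  also have "\<dots> = (\<Sum>k<n. \<Sum>l<n. if a < n \<and> b < n then
      pd a (\<lambda>x. F x k) (cart_proj n y) * pd b (\<lambda>x. F x l) (cart_proj n y) * h (F (cart_proj n y)) k l else 0)"
    by (intro sum.cong refl) (simp only: lessThan_iff pd_suspension, simp)
  finally show ?thesis by (auto simp: pullback_def)
qed

lemma smooth_extend_form:
  assumes "\<forall>a<n. \<forall>b<n. smooth n G (\<lambda>x. h x a b)"
  shows "smooth (n + 2) {z \<in> cart (n + 2). cart_proj n z \<in> G} (\<lambda>y. extend_form n h y a b)"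
proof (cases "a < n \<and> b < n")
  case True
  then have "smooth n G (\<lambda>x. h x a b)" using assms by blast
  from smooth_cart_proj[OF this] show ?thesis using True by (simp add: extend_form_def)
next
  case False
  then have "(\<lambda>y. extend_form n h y a b) = (\<lambda>y. 0)" by (auto simp: extend_form_def)
  then show ?thesis by (simp add: smooth_const)
qed

lemma pd_extend_form:
  assumes "n \<le> k"
  shows "pd k (\<lambda>z. extend_form n h z a b) y = 0"
proof (cases "a < n \<and> b < n")
  case True
  then show ?thesis
    using assms pd_cart_proj[of k "\<lambda>x. h x a b" n] by (simp add: extend_form_def)
next
  case False
  then have "(\<lambda>y. extend_form n h y a b) = (\<lambda>y. 0)" by (auto simp: extend_form_def)
  then show ?thesis by (simp add: pd_const)
qed

lemma leaf_vector_extend_form: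
  assumes "leaf_vector n v"
  shows "(\<Sum>i<n + 2. v i * extend_form n h y i j) = 0"
  using assms by (intro sum.neutral) (auto simp: leaf_vector_def extend_form_def)

text \<open>Each summand vanishes separately. For \<open>k < n\<close> the component of
  \<open>Y\<close> is zero on an open set, hence so are its derivatives; for larger \<open>k\<close>
  the form neither varies with coordinate \<open>k\<close> nor has an entry with that index.\<close>

lemma lie_derivative_extend_form:
  assumes "openin (Euclidean_space (n + 2)) G" "y \<in> G" "\<And>z. z \<in> G \<Longrightarrow> leaf_vector n (Y z)"
    "i < n + 2" "j < n + 2"
  shows "lie_derivative (n + 2) Y (extend_form n h) y i j = 0"
  unfolding lie_derivative_def
proof (intro sum.neutral ballI)
  fix k
  have *: "pd a (\<lambda>z. Y z k) y = 0" if "k < n" "a < n + 2" for a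
  proof -
    have "pd a (\<lambda>z. Y z k) y = pd a (\<lambda>z. 0) y"
      by (rule pd_cong[OF assms(1,2) that(2)]) (use assms(3) that(1) in \<open>auto simp: leaf_vector_def\<close>)
    then show ?thesis by (simp add: pd_const)
  qed
  show "Y y k * pd k (\<lambda>z. extend_form n h z i j) y + extend_form n h y k j * pd i (\<lambda>z. Y z k) y +
      extend_form n h y i k * pd j (\<lambda>z. Y z k) y = 0"
  proof (cases "k < n")
    case True
    then have "Y y k = 0" using assms(2,3) by (auto simp: leaf_vector_def)
    then show ?thesis using *[OF True assms(4)] *[OF True assms(5)] by simp
  next
    case False
    then show ?thesis using pd_extend_form[of n k] by (simp add: extend_form_def)
  qed
qed

context gluing
begin

text \<open>As the identity is one of the gluing maps, \<open>invariant\<close> includes the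
  transformation law of \<open>h\<close> between charts of \<open>A\<close>.\<close>

theorem riemannian_foliation_M:
  assumes metric: "\<And>c. c \<in> A \<Longrightarrow> riemannian_metric n (chart_image c) (h c)"
    and invariant: "\<And>S f d c c' x a b. (S, f, d) \<in> gluing_maps N \<psi> \<Longrightarrow> c \<in> A \<Longrightarrow> c' \<in> A \<Longrightarrow> x \<in> fst c \<inter> S \<Longrightarrow>
      f x \<in> fst c' \<Longrightarrow> a < n \<Longrightarrow> b < n \<Longrightarrow>
      pullback n (snd c' \<circ> f \<circ> inv_into (fst c) (snd c)) (h c') (snd c x) a b = h c (snd c x) a b"
  shows "riemannian_foliation (n + 2) n M (M_charts n N A \<psi>)"
proof -
  have "\<exists>U \<phi> Q. (U, \<phi>) \<in> A \<and> openin W Q \<and> Q \<subseteq> U \<times> UNIV \<times> UNIV \<and> inj_on \<pi> Q \<and>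
      c = (\<pi> ` Q, product_coords n \<phi> \<circ> inv_into Q \<pi>)" if "c \<in> M_charts n N A \<psi>" for c
    using that unfolding M_charts_iff .
  \<comment> \<open>A chart of M does not remember the chart of \<open>N\<close> that it comes from,
    so one is chosen for each. The transformation law below holds for all pairs of choices, which
    makes the components consistent.\<close>
  then obtain U \<phi> Q where base: "\<And>c. c \<in> M_charts n N A \<psi> \<Longrightarrow> (U c, \<phi> c) \<in> A \<and> openin W (Q c) \<and>
      Q c \<subseteq> U c \<times> UNIV \<times> UNIV \<and> inj_on \<pi> (Q c) \<and> c = (\<pi> ` Q c, product_coords n (\<phi> c) \<circ> inv_into (Q c) \<pi>)"
    by metis
  note b = base[THEN conjunct1] base[THEN conjunct2, THEN conjunct1] base[THEN conjunct2, THEN conjunct2, THEN conjunct1]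
    base[THEN conjunct2, THEN conjunct2, THEN conjunct2, THEN conjunct1]
    base[THEN conjunct2, THEN conjunct2, THEN conjunct2, THEN conjunct2]
  define g where "g c = extend_form n (h (U c, \<phi> c))" for c :: "('a \<times> real \<times> real) set chart"
  have image: "chart_image c \<subseteq> {z \<in> cart (n + 2). cart_proj n z \<in> chart_image (U c, \<phi> c)}"
    and open_image: "openin (Euclidean_space (n + 2)) (chart_image c)" if c: "c \<in> M_charts n N A \<psi>" for c
  proof -
    show o: "openin (Euclidean_space (n + 2)) (chart_image c)"
      unfolding quotient_chart(1)[OF b[OF c]] by (rule product_chart(1)[OF b(1-3)[OF c]])
    have "cart_proj n (product_coords n (\<phi> c) w) \<in> \<phi> c ` U c" if "w \<in> Q c" for w
    proof -
      obtain x s t where w: "w = (x, s, t)" by (cases w)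
      then have "x \<in> U c" using that b(3)[OF c] by blast
      then show ?thesis
        using w chart_D(4)[OF b(1)[OF c]] cart_proj_upd2[of "\<phi> c x" n s t] by auto
    qed
    then show "chart_image c \<subseteq> {z \<in> cart (n + 2). cart_proj n z \<in> chart_image (U c, \<phi> c)}"
      using openin_subset[OF o] unfolding quotient_chart(1)[OF b[OF c]] by (auto simp: chart_image_def)
  qed
  have law: "g c y i j = pullback (n + 2) (coord_change c c') (g c') y i j"
    if c: "c \<in> M_charts n N A \<psi>" and c': "c' \<in> M_charts n N A \<psi>" and y: "y \<in> snd c ` (fst c \<inter> fst c')"
      and ij: "i < n + 2" "j < n + 2" for c c' y i j
  proof -
    obtain S f d B where B: "(S, f, d) \<in> gluing_maps N \<psi>" "openin (Euclidean_space (n + 2)) B" "y \<in> B"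
      "B \<subseteq> snd c ` (fst c \<inter> fst c')" "\<forall>z\<in>B. cart_proj n z \<in> \<phi> c ` {x \<in> U c \<inter> S. f x \<in> U c'}"
      "\<forall>z\<in>B. coord_change c c' z =
        ((\<phi> c' \<circ> f \<circ> inv_into (U c) (\<phi> c)) (cart_proj n z))(n := z n, n + 1 := z (n + 1) + d)"
      by (rule coord_change_locally[OF b[OF c] b[OF c'] y])
    let ?F = "\<phi> c' \<circ> f \<circ> inv_into (U c) (\<phi> c)"
    obtain x where x: "x \<in> U c \<inter> S" "f x \<in> U c'" "cart_proj n y = \<phi> c x" using B(3,5) by blast
    have "?F (\<phi> c x) = \<phi> c' (f x)"
      using chart_D(3)[OF b(1)[OF c]] x(1) by simp
    then have F: "?F (cart_proj n y) \<in> cart n"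
      using chart_D(4)[OF b(1)[OF c']] x(2,3) by auto
    \<comment> \<open>A pullback at \<open>y\<close> involves only the germ of the map, so the local
      formula may replace the coordinate change.\<close>
    have "pullback (n + 2) (coord_change c c') (g c') y i j =
        pullback (n + 2) (\<lambda>z. (?F (cart_proj n z))(n := z n, n + 1 := z (n + 1) + d)) (g c') y i j"
      by (rule pullback_cong[OF B(2,3) _ _ ij]) (use B(3,6) in auto)
    also have "\<dots> = (if i < n \<and> j < n then pullback n ?F (h (U c', \<phi> c')) (cart_proj n y) i j else 0)"
      unfolding g_def by (rule pullback_suspension[of ?F n y, OF F])
    \<comment> \<open>Invariance of the metric under the gluing maps enters here, at the base point
      \<open>x\<close> below \<open>y\<close>.\<close>
    also have "\<dots> = g c y i j"
      using invariant[OF B(1) b(1)[OF c] b(1)[OF c'], of x i j] x by (simp add: g_def extend_form_def)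
    finally show ?thesis by simp
  qed
  have smooth: "smooth (n + 2) (chart_image c) (\<lambda>y. g c y i j)" if c: "c \<in> M_charts n N A \<psi>" for c i j
    unfolding g_def
    by (rule smooth_subset[OF smooth_extend_form image[OF c]])
      (use metric[OF b(1)[OF c]] in \<open>simp add: riemannian_metric_def\<close>)
  have form: "(\<forall>i<n + 2. \<forall>j<n + 2. g c y i j = g c y j i) \<and>
      (\<forall>v. 0 \<le> bilinear_form (n + 2) (g c y) v v) \<and>
      (\<forall>v w. leaf_vector n v \<longrightarrow> bilinear_form (n + 2) (g c y) v w = 0) \<and>
      (\<forall>v. \<not> leaf_vector n v \<longrightarrow> 0 < bilinear_form (n + 2) (g c y) v v)"
    if c: "c \<in> M_charts n N A \<psi>" and y: "y \<in> chart_image c" for c y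
  proof -
    let ?h = "h (U c, \<phi> c) (cart_proj n y)"
    have "cart_proj n y \<in> chart_image (U c, \<phi> c)" using image[OF c] y by blast
    then have sym: "\<forall>a<n. \<forall>b<n. ?h a b = ?h b a"
      and pos: "\<And>v. \<exists>a<n. v a \<noteq> 0 \<Longrightarrow> 0 < bilinear_form n ?h v v"
      using metric[OF b(1)[OF c]] unfolding riemannian_metric_def by blast+
    have pos': "0 < bilinear_form n ?h v v" if "\<not> leaf_vector n v" for v
      using pos that unfolding leaf_vector_def by blast
    have leaf: "bilinear_form n ?h v w = 0" if "leaf_vector n v" for v w
      using that by (simp add: leaf_vector_def bilinear_form_def)
    have "0 \<le> bilinear_form n ?h v v" for v
      using pos'[of v] leaf[of v v] by (cases "leaf_vector n v") auto
    then show ?thesis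
      using sym pos' leaf unfolding g_def bilinear_form_extend_form by (auto simp: extend_form_def)
  qed
  have "tensor_field_02 (n + 2) (M_charts n N A \<psi>) g"
    unfolding tensor_field_02_def by (intro conjI ballI allI impI) (rule smooth law, assumption+)+
  moreover have "\<forall>c\<in>M_charts n N A \<psi>. \<forall>y\<in>chart_image c. \<forall>j<n + 2. (\<Sum>i<n + 2. Y c y i * g c y i j) = 0"
    "\<forall>c\<in>M_charts n N A \<psi>. \<forall>y\<in>chart_image c. \<forall>i<n + 2. \<forall>j<n + 2. lie_derivative (n + 2) (Y c) (g c) y i j = 0"
    if Y: "\<forall>c\<in>M_charts n N A \<psi>. \<forall>y\<in>chart_image c. leaf_vector n (Y c y)" for Y
  proof (intro ballI allI impI)
    fix c y j assume "c \<in> M_charts n N A \<psi>" "y \<in> chart_image c"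
    then have "leaf_vector n (Y c y)" using Y by blast
    then show "(\<Sum>i<n + 2. Y c y i * g c y i j) = 0"
      unfolding g_def by (rule leaf_vector_extend_form)
  next
    show "\<forall>c\<in>M_charts n N A \<psi>. \<forall>y\<in>chart_image c. \<forall>i<n + 2. \<forall>j<n + 2. lie_derivative (n + 2) (Y c) (g c) y i j = 0"
    proof (intro ballI allI impI)
      fix c y i j assume c: "c \<in> M_charts n N A \<psi>" and y: "y \<in> chart_image c" and ij: "i < n + 2" "j < n + 2"
      have "leaf_vector n (Y c z)" if "z \<in> chart_image c" for z using Y c that by blast
      then show "lie_derivative (n + 2) (Y c) (g c) y i j = 0"
        unfolding g_def by (rule lie_derivative_extend_form[OF open_image[OF c] y _ ij])
    qed
  qed
  ultimately have "transversely_riemannian_metric (n + 2) n (M_charts n N A \<psi>) g"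
    unfolding transversely_riemannian_metric_def using form by simp
  then show ?thesis
    unfolding riemannian_foliation_def using foliated_manifold_M by blast
qed

end

section \<open>Disjoint unions of open subsets of Cartesian spaces\<close>

lemma Hausdorff_space_sum_topology:
  assumes "\<And>i. i \<in> I \<Longrightarrow> Hausdorff_space (X i)"
  shows "Hausdorff_space (sum_topology X I)"
  unfolding Hausdorff_space_def
proof (intro allI impI)
  fix p q assume *: "p \<in> topspace (sum_topology X I) \<and> q \<in> topspace (sum_topology X I) \<and> p \<noteq> q"
  obtain i x j y where pq: "p = (i, x)" "q = (j, y)" by (cases p, cases q)
  with * have ij: "i \<in> I" "x \<in> topspace (X i)" "j \<in> I" "y \<in> topspace (X j)" by auto
  have o: "openin (sum_topology X I) (Pair i ` G)" if "i \<in> I" "openin (X i) G" for i G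
    using that open_map_component_injection[of i I X] by (auto simp: open_map_def)
  show "\<exists>G H. openin (sum_topology X I) G \<and> openin (sum_topology X I) H \<and> p \<in> G \<and> q \<in> H \<and> disjnt G H"
  proof (cases "i = j")
    case True
    then have "x \<in> topspace (X i) \<and> y \<in> topspace (X i) \<and> x \<noteq> y" using ij * pq by auto
    then obtain G H where "openin (X i) G" "openin (X i) H" "x \<in> G" "y \<in> H" "disjnt G H"
      using assms[OF ij(1)] unfolding Hausdorff_space_def by meson
    then show ?thesis
      using o ij True pq by (intro exI[of _ "Pair i ` G"] exI[of _ "Pair i ` H"]) (auto simp: disjnt_def)
  next
    case False
    then show ?thesis
      using o ij pq
      by (intro exI[of _ "Pair i ` topspace (X i)"] exI[of _ "Pair j ` topspace (X j)"]) (auto simp: disjnt_def)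
  qed
qed

lemma inv_into_snd: "y \<in> V \<Longrightarrow> inv_into ({i} \<times> V) snd y = (i, y)"
  by (rule inv_into_f_eq) (auto simp: inj_on_def)

lemma smooth_manifold_union:
  assumes I: "countable I" and V: "\<And>i. i \<in> I \<Longrightarrow> openin (Euclidean_space n) (V i)"
  shows "smooth_manifold n (union_topology n I V) (union_charts I V)"
proof -
  let ?N = "union_topology n I V"
  have top: "topspace ?N = Sigma I V"
    using V[THEN openin_subset] by (fastforce simp: union_topology_def)
  have o: "openin ?N ({i} \<times> G)" if "i \<in> I" "openin (Euclidean_space n) G" "G \<subseteq> V i" for i G
  proof -
    have "openin (subtopology (Euclidean_space n) (V i)) G"
      using that by (auto simp: openin_subtopology)
    then have "openin ?N (Pair i ` G)"
      using open_map_component_injection[OF that(1), of "\<lambda>i. subtopology (Euclidean_space n) (V i)"]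
      by (simp add: open_map_def union_topology_def)
    moreover have "Pair i ` G = {i} \<times> G" by auto
    ultimately show ?thesis by simp
  qed
  have chart: "is_chart n ?N ({i} \<times> V i, snd)" if i: "i \<in> I" for i
  proof -
    have im: "snd ` ({i} \<times> V i) = V i" by force
    have t: "topspace (subtopology ?N ({i} \<times> V i)) = {i} \<times> V i" "topspace (subtopology (Euclidean_space n) (V i)) = V i"
      using i V[OF i, THEN openin_subset] by (auto simp: top)
    have "continuous_map (subtopology ?N ({i} \<times> V i)) (subtopology (Euclidean_space n) (V i)) snd"
      unfolding continuous_map_def
    proof (intro conjI allI impI)
      fix G assume "openin (subtopology (Euclidean_space n) (V i)) G"
      then have "openin (Euclidean_space n) G" "G \<subseteq> V i"
        using V[OF i] by (auto simp: openin_open_subtopology)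
      moreover have "{p \<in> {i} \<times> V i. snd p \<in> G} = {i} \<times> G" using calculation by auto
      ultimately show "openin (subtopology ?N ({i} \<times> V i)) {p \<in> topspace (subtopology ?N ({i} \<times> V i)). snd p \<in> G}"
        unfolding t using o[OF i] V[OF i] by (auto simp: openin_open_subtopology)
    qed (simp only: t, auto)
    moreover have "continuous_map (subtopology (Euclidean_space n) (V i)) (subtopology ?N ({i} \<times> V i)) (Pair i)"
      using continuous_map_component_injection[OF i, of "\<lambda>i. subtopology (Euclidean_space n) (V i)"]
      by (auto simp: continuous_map_in_subtopology union_topology_def)
    ultimately have "homeomorphic_maps (subtopology ?N ({i} \<times> V i)) (subtopology (Euclidean_space n) (V i)) snd (Pair i)"
      unfolding homeomorphic_maps_def t by auto
    then show ?thesis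
      using o[OF i V[OF i]] V[OF i] homeomorphic_maps_imp_map by (simp add: is_chart_def chart_image_def im)
  qed
  have change: "smooth_map n n (snd ` (({i} \<times> V i) \<inter> ({j} \<times> V j))) (coord_change ({i} \<times> V i, snd) ({j} \<times> V j, snd))"
    if "i \<in> I" "j \<in> I" for i j
  \<comment> \<open>A point in the overlap forces \<open>j = i\<close>, so arguing pointwise covers
    distinct indices as well: their overlap is empty.\<close>
  proof (rule smooth_map_locally)
    fix y assume "y \<in> snd ` (({i} \<times> V i) \<inter> ({j} \<times> V j))"
    then have ij: "j = i" "y \<in> V i" by auto
    have im: "snd ` (({i} \<times> V i) \<inter> ({j} \<times> V j)) = V i" using ij by force
    have "smooth_map n n (V i) (\<lambda>y. y)"
      using openin_subset[OF V[OF that(1)]] smooth_component_add[of n "V i" _ 0] by (auto simp: smooth_map_def)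
    then show "\<exists>Q g. openin (Euclidean_space n) Q \<and> y \<in> Q \<and> Q \<subseteq> snd ` (({i} \<times> V i) \<inter> ({j} \<times> V j)) \<and>
        (\<forall>y\<in>Q. coord_change ({i} \<times> V i, snd) ({j} \<times> V j, snd) y = g y) \<and> smooth_map n n Q g"
      unfolding im using ij V[OF that(1)]
      by (intro exI[of _ "V i"] exI[of _ "\<lambda>y. y"]) (simp add: coord_change_def inv_into_snd)
  qed
  have "Hausdorff_space ?N"
    unfolding union_topology_def
    by (intro Hausdorff_space_sum_topology Hausdorff_space_subtopology Hausdorff_Euclidean_space)
  moreover have "second_countable ?N"
    unfolding union_topology_def
    by (intro second_countable_sum_topology I second_countable_subtopology second_countable_Euclidean_space)
  ultimately show ?thesis
    unfolding smooth_manifold_def union_charts_def using chart change top by auto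
qed

text \<open>
  The index is recovered from the domain of the chart; for an empty domain the value is arbitrary,
  which is harmless as there is then no point to evaluate it at.
\<close>

definition union_metric :: "('i \<Rightarrow> (nat \<Rightarrow> real) \<Rightarrow> nat \<Rightarrow> nat \<Rightarrow> real) \<Rightarrow>
    ('i \<times> (nat \<Rightarrow> real)) chart \<Rightarrow> (nat \<Rightarrow> real) \<Rightarrow> nat \<Rightarrow> nat \<Rightarrow> real" where
  "union_metric h c = h (fst (SOME p. p \<in> fst c))"

lemma union_metric_eq:
  assumes "V \<noteq> {}"
  shows "union_metric h ({i} \<times> V, \<phi>) = h i"
proof -
  obtain x where "(i, x) \<in> {i} \<times> V" using assms by blast
  then have "(SOME p. p \<in> {i} \<times> V) \<in> {i} \<times> V" by (rule someI)
  then have "fst (SOME p. p \<in> {i} \<times> V) = i" by auto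
  then show ?thesis by (simp only: union_metric_def fst_conv)
qed

lemma smooth_empty: "smooth n {} f"
  by (rule smooth_locally) simp

lemma pullback_id:
  assumes "a < n" "b < n"
  shows "pullback n (\<lambda>y. y) h x a b = h x a b"
proof -
  have "pd i (\<lambda>y. y k) x = (if i = k then 1 else 0)" for i k :: nat
    using pd_component_add[of i k 0] by simp
  then have "pullback n (\<lambda>y. y) h x a b = (\<Sum>k<n. \<Sum>l<n. if a = k then (if b = l then h x k l else 0) else 0)"
    unfolding pullback_def by (intro sum.cong refl) simp
  also have "\<dots> = (\<Sum>k<n. if a = k then (\<Sum>l<n. if b = l then h x k l else 0) else 0)"
    by (intro sum.cong refl) simp
  also have "\<dots> = h x a b"
    using assms by (simp add: sum.delta)
  finally show ?thesis .
qed

theorem corollary7p3: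
  fixes n :: nat
    and X :: "'x set" and D :: "'x plot set"
    and I :: "'i set" and U :: "'i \<Rightarrow> 'x set" and F :: "'i \<Rightarrow> 'x \<Rightarrow> (nat \<Rightarrow> real) set"
    and V :: "'i \<Rightarrow> (nat \<Rightarrow> real) set" and \<Gamma> :: "'i \<Rightarrow> ((nat \<Rightarrow> real) \<Rightarrow> nat \<Rightarrow> real) set"
    and \<psi> :: "nat \<Rightarrow> 'i \<times> (nat \<Rightarrow> real) \<rightharpoonup> 'i \<times> (nat \<Rightarrow> real)"
    and h :: "'i \<Rightarrow> (nat \<Rightarrow> real) \<Rightarrow> nat \<Rightarrow> nat \<Rightarrow> real"
  assumes "diffeological_quasifold n X D"
    and "countable_atlas n X D I U F V \<Gamma>"
    and "generates_pseudogroup n (union_topology n I V) (union_charts I V)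
           (\<psi> ` {1..}) (atlas_pseudogroup n I U F V \<Gamma>)"
    and "\<And>i. i \<in> I \<Longrightarrow> riemannian_metric n (V i) (h i)"
    and "\<And>i. i \<in> I \<Longrightarrow> acts_by_isometries n (\<Gamma> i) (V i) (h i)"
    and "\<And>\<phi>. \<phi> \<in> atlas_pseudogroup n I U F V \<Gamma> \<Longrightarrow> local_isometry n h \<phi>"
  shows "riemannian_foliation (n + 2) n
           (M_topology (union_topology n I V) \<psi>)
           (M_charts n (union_topology n I V) (union_charts I V) \<psi>)"
proof -
  let ?N = "union_topology n I V" and ?A = "union_charts I V"
  have I: "countable I" and V: "\<And>i. i \<in> I \<Longrightarrow> openin (Euclidean_space n) (V i)"
    using assms(2) by (auto simp: countable_atlas_def quasifold_chart_def)
  let ?P = "atlas_pseudogroup n I U F V \<Gamma>"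
  have P: "?P = \<Inter>{P. pseudogroup n ?N ?A P \<and> \<psi> ` {1..} \<subseteq> P}"
    and gen: "\<And>i. i \<ge> 1 \<Longrightarrow> transition n ?N ?A (\<psi> i)"
    using assms(3) unfolding generates_pseudogroup_def by blast+
  \<comment> \<open>Read off from the intersection: every pseudogroup containing the generators
    contains their inverses. This makes the isometry hypothesis available for all gluing maps other
    than the identity.\<close>
  have \<psi>: "\<psi> i \<in> ?P" "partial_inverse (\<psi> i) \<in> ?P" if "i \<ge> 1" for i
  proof -
    have "\<psi> i \<in> P \<and> partial_inverse (\<psi> i) \<in> P" if "pseudogroup n ?N ?A P" "\<psi> ` {1..} \<subseteq> P" for P
    proof -
      have "\<psi> i \<in> P" using that(2) \<open>i \<ge> 1\<close> by auto
      then show ?thesis using that(1) unfolding pseudogroup_def by blast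
    qed
    then show "\<psi> i \<in> ?P" "partial_inverse (\<psi> i) \<in> ?P"
      unfolding P by blast+
  qed
  interpret gluing n ?N ?A \<psi>
    by (rule gluing.intro) (rule smooth_manifold_union[OF I V] gen, assumption)+
  \<comment> \<open>Translates \<open>local_isometry\<close> into charts: the inverse of the chart
    on piece \<open>i\<close> is \<open>y \<mapsto> (i, y)\<close>, and the target index
    \<open>j\<close> is that of the image point.\<close>
  have isometry: "pullback n (snd \<circ> (the \<circ> \<phi>) \<circ> inv_into ({i} \<times> V i) snd) (h j) v a b = h i v a b"
    if \<phi>: "\<phi> \<in> atlas_pseudogroup n I U F V \<Gamma>" and i: "i \<in> I" "v \<in> V i" "(i, v) \<in> dom \<phi>"
      and j: "the (\<phi> (i, v)) \<in> {j} \<times> V j" and ab: "a < n" "b < n" for \<phi> i j v a b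
  proof -
    have "pullback n (snd \<circ> (the \<circ> \<phi>) \<circ> inv_into ({i} \<times> V i) snd) (h j) v a b =
        pullback n (\<lambda>y. snd (the (\<phi> (i, y)))) (h j) v a b"
      by (rule pullback_cong[OF V[OF i(1)] i(2) _ _ ab]) (use i(2) in \<open>simp_all add: inv_into_snd\<close>)
    also have "\<dots> = h i v a b"
      using assms(6)[OF \<phi>] i(3) j ab unfolding local_isometry_def by (force simp: Let_def)
    finally show ?thesis .
  qed
  show ?thesis
  proof (rule riemannian_foliation_M)
    fix c assume "c \<in> ?A"
    then obtain i where i: "i \<in> I" "c = ({i} \<times> V i, snd)" by (auto simp: union_charts_def)
    have im: "chart_image c = V i" using i(2) by (force simp: chart_image_def)
    show "riemannian_metric n (chart_image c) (union_metric h c)"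
    \<comment> \<open>For an empty piece \<open>union_metric\<close> may pick the form of another
      index, but then every condition is vacuous.\<close>
    proof (cases "V i = {}")
      case True
      then show ?thesis unfolding im by (simp add: riemannian_metric_def smooth_empty)
    next
      case False
      then show ?thesis unfolding im using assms(4)[OF i(1)] by (simp add: i(2) union_metric_eq)
    qed
  next
    fix S f d c c' x a b
    assume f: "(S, f, d) \<in> gluing_maps ?N \<psi>" and c: "c \<in> ?A" "c' \<in> ?A"
      and x: "x \<in> fst c \<inter> S" "f x \<in> fst c'" and ab: "a < n" "b < n"
    obtain i j where ij: "i \<in> I" "c = ({i} \<times> V i, snd)" "j \<in> I" "c' = ({j} \<times> V j, snd)"
      using c by (auto simp: union_charts_def)
    obtain v where v: "x = (i, v)" "v \<in> V i" using x(1) ij(2) by auto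
    \<comment> \<open>The point \<open>x\<close> and its image show that both pieces are nonempty,
      so the indices are recovered correctly.\<close>
    have h: "union_metric h c = h i" "union_metric h c' = h j"
      using v(2) x(2) ij by (auto intro!: union_metric_eq)
    \<comment> \<open>The range of a generator is the domain of its partial inverse, so generators
      and their inverses are treated alike, as members of the pseudogroup.\<close>
    have "S = topspace ?N \<and> f = id \<or> (\<exists>\<phi>\<in>?P. S = dom \<phi> \<and> f = the \<circ> \<phi>)"
    proof -
      have ran: "ran \<phi> = dom (partial_inverse \<phi>)" for \<phi> :: "'i \<times> (nat \<Rightarrow> real) \<rightharpoonup> 'i \<times> (nat \<Rightarrow> real)"
        by (auto simp: partial_inverse_def split: if_splits)
      consider "S = topspace ?N" "f = id" |
        k where "k \<ge> 1" "S = dom (\<psi> k)" "f = the \<circ> \<psi> k" |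
        k where "k \<ge> 1" "S = dom (partial_inverse (\<psi> k))" "f = the \<circ> partial_inverse (\<psi> k)"
        using f unfolding gluing_maps_def ran by blast
      then show ?thesis
        using \<psi> by cases blast+
    qed
    then consider "S = topspace ?N" "f = id" | \<phi> where "\<phi> \<in> ?P" "S = dom \<phi>" "f = the \<circ> \<phi>"
      by blast
    then show "pullback n (snd c' \<circ> f \<circ> inv_into (fst c) (snd c)) (union_metric h c') (snd c x) a b =
        union_metric h c (snd c x) a b"
    proof cases
      case 1
      \<comment> \<open>The identity preserves the index, so both charts carry the same
        form.\<close>
      then have "j = i" using x(2) v ij(4) by auto
      have "pullback n (snd \<circ> id \<circ> inv_into ({i} \<times> V i) snd) (h i) v a b = pullback n (\<lambda>y. y) (h i) v a b"
        by (rule pullback_cong[OF V[OF ij(1)] v(2) _ _ ab]) (use v(2) in \<open>simp_all add: inv_into_snd\<close>)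
      then show ?thesis
        using pullback_id[OF ab] 1 \<open>j = i\<close> by (simp add: h) (simp add: ij v)
    next
      case 2
      have "pullback n (snd \<circ> (the \<circ> \<phi>) \<circ> inv_into ({i} \<times> V i) snd) (h j) v a b = h i v a b"
        by (rule isometry[OF 2(1) ij(1) v(2) _ _ ab]) (use x v ij 2 in auto)
      then show ?thesis unfolding h by (simp only: ij v 2 fst_conv snd_conv)
    qed
  qed
qed

end
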